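(* Let $G$ be an infinite graph. The topological ends of $G$ are exactly the almost non-dominated edge-ends of $G$, that is, the image set of $f_E=f\circ\phi:\Omega'(G)\to\Omega_E(G)$ is exactly the subset of edge-ends that are almost non-dominated. Here an edge-end $\varepsilon\in\Omega_E(G)$ is called almost non-dominated if there exists at least one ray $r\in\varepsilon$ such that $r$ is non-dominated.
   Context: Rays and ends. A ray in $G$ is a one-way infinite path; a tail of a ray is an infinite connected subgraph of it. Let $\mathcal{R}(G)$ be the set of rays of $G$. Two rays $r,s$ are equivalent, $r\sim s$, if for every finite $X\subset V(G)$ they have tails in the same connected component of $G\setminus X$. The equivalence class of $r$ is denoted $[r]$, and $\Omega(G)=\mathcal{R}(G)/\sim$ is the set of ends of $G$. Edge-ends. Two rays $r,s$ are edge-equivalent, $r\sim_E s$, if for every finite $X\subset E(G)$ they have tails in the same connected component of $G\setminus X$. The class of $r$ is $[r]_E$, and $\Omega_E(G)=\mathcal{R}(G)/\sim_E$ is the set of edge-ends of $G$. The map $f:\Omega(G)\to\Omega_E(G)$, $[r]\mapsto[r]_E$, is the natural surjection. Domination. A vertex $v\in V(G)$ dominates a ray $r$ if there are infinitely many paths from $v$ to $r$ that are pairwise disjoint except at $v$. A ray is non-dominated if no vertex of $G$ dominates it. An end is non-dominated if its rays are non-dominated (equivalent rays are dominated by the same vertices). Topological ends. Let $X$ be a Hausdorff topological space. Consider decreasing chains $A_0\supset A_1\supset A_2\supset\cdots$ of open sets of $X$ such that each boundary $\partial A_n$ is compact and $\bigcap_{n\in\mathbb{N}}\overline{A_n}=\emptyset$.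 Two such sequences $\langle A_n:n\in\mathbb{N}\rangle$ and $\langle B_n:n\in\mathbb{N}\rangle$ are equivalent if for every $n\in\mathbb{N}$ there exist $m,k\in\mathbb{N}$ such that $A_n\supset B_m$ and $B_n\supset A_k$. The equivalence classes of these sequences are the topological ends of $X$. The graph $G$ is equipped with the topology of the 1-simplex (that is, $G$ is viewed as a 1-complex, each edge being a copy of $[0,1]$), and $\Omega'(G)$ denotes the set of topological ends of $G$. The map $\phi$. $\phi:\Omega'(G)\to\Omega(G)$ is the natural injective function of Diestel and Kühn, which maps each topological end of $G$ to a non-dominated end of $G$ and gives a bijection between the topological ends of $G$ and the non-dominated ends of $G$.
   Formalization: The open sets A_n in the sequences defining topological ends are additionally required to be non-empty and connected; without this, on a double ray the sets {|x|>n} would define an extra topological end and the injective map φ would not exist. *)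

theory Defs
  imports "HOL-Analysis.Analysis"
begin

section \<open>Graphs\<close>

record 'v ugraph =
  verts :: "'v set"
  edges :: "'v set set"

definition simple_graph :: "'v ugraph \<Rightarrow> bool" where
  "simple_graph G \<longleftrightarrow>
     (\<forall>e\<in>edges G. \<exists>u v. u \<in> verts G \<and> v \<in> verts G \<and> u \<noteq> v \<and> e = {u, v})"

definition subgraph :: "'v ugraph \<Rightarrow> 'v ugraph \<Rightarrow> bool" where
  "subgraph H G \<longleftrightarrow> simple_graph H \<and> verts H \<subseteq> verts G \<and> edges H \<subseteq> edges G"

definition connected_graph :: "'v ugraph \<Rightarrow> bool" where
  "connected_graph G \<longleftrightarrow> verts G \<noteq> {} \<and>
     (\<forall>u\<in>verts G. \<forall>v\<in>verts G. (\<lambda>x y. {x, y} \<in> edges G)\<^sup>*\<^sup>* u v)"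

definition graph_component :: "'v ugraph \<Rightarrow> 'v ugraph \<Rightarrow> bool" where
  "graph_component C G \<longleftrightarrow> subgraph C G \<and> connected_graph C \<and>
     (\<forall>D. subgraph D G \<and> connected_graph D \<and> subgraph C D \<longrightarrow> D = C)"

definition del_verts :: "'v ugraph \<Rightarrow> 'v set \<Rightarrow> 'v ugraph" where
  "del_verts G X = \<lparr>verts = verts G - X, edges = {e \<in> edges G. e \<inter> X = {}}\<rparr>"

definition del_edges :: "'v ugraph \<Rightarrow> 'v set set \<Rightarrow> 'v ugraph" where
  "del_edges G X = \<lparr>verts = verts G, edges = edges G - X\<rparr>"


section \<open>Rays, ends and edge-ends\<close>

text \<open>A ray is given by its sequence of vertices in order; this loses nothing, as a one-way
  infinite path has a unique first vertex.\<close>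

definition rays :: "'v ugraph \<Rightarrow> (nat \<Rightarrow> 'v) set" where
  "rays G = {r. inj r \<and> range r \<subseteq> verts G \<and> (\<forall>i. {r i, r (Suc i)} \<in> edges G)}"

definition ray_graph :: "(nat \<Rightarrow> 'v) \<Rightarrow> 'v ugraph" where
  "ray_graph r = \<lparr>verts = range r, edges = range (\<lambda>i. {r i, r (Suc i)})\<rparr>"

definition is_tail :: "'v ugraph \<Rightarrow> (nat \<Rightarrow> 'v) \<Rightarrow> bool" where
  "is_tail T r \<longleftrightarrow> subgraph T (ray_graph r) \<and> connected_graph T \<and> infinite (verts T)"

definition tails_in_same_component :: "'v ugraph \<Rightarrow> (nat \<Rightarrow> 'v) \<Rightarrow> (nat \<Rightarrow> 'v) \<Rightarrow> bool" where
  "tails_in_same_component H r s \<longleftrightarrow>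
     (\<exists>C T S. graph_component C H \<and> is_tail T r \<and> is_tail S s \<and> subgraph T C \<and> subgraph S C)"

definition end_rel :: "'v ugraph \<Rightarrow> ((nat \<Rightarrow> 'v) \<times> (nat \<Rightarrow> 'v)) set" where
  "end_rel G = {(r, s). r \<in> rays G \<and> s \<in> rays G \<and>
     (\<forall>X. finite X \<and> X \<subseteq> verts G \<longrightarrow> tails_in_same_component (del_verts G X) r s)}"

definition edge_end_rel :: "'v ugraph \<Rightarrow> ((nat \<Rightarrow> 'v) \<times> (nat \<Rightarrow> 'v)) set" where
  "edge_end_rel G = {(r, s). r \<in> rays G \<and> s \<in> rays G \<and>
     (\<forall>X. finite X \<and> X \<subseteq> edges G \<longrightarrow> tails_in_same_component (del_edges G X) r s)}"

definition ends :: "'v ugraph \<Rightarrow> (nat \<Rightarrow> 'v) set set" where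
  "ends G = rays G // end_rel G"

definition edge_ends :: "'v ugraph \<Rightarrow> (nat \<Rightarrow> 'v) set set" where
  "edge_ends G = rays G // edge_end_rel G"

text \<open>The map sending the end of \<open>r\<close> to the edge-end of \<open>r\<close>: all rays in an end have the same
  edge-end, so the union below is that single class.\<close>

definition end_to_edge_end :: "'v ugraph \<Rightarrow> (nat \<Rightarrow> 'v) set \<Rightarrow> (nat \<Rightarrow> 'v) set" where
  "end_to_edge_end G \<omega> = (\<Union>r\<in>\<omega>. edge_end_rel G `` {r})"


section \<open>Domination\<close>

definition is_path :: "'v ugraph \<Rightarrow> 'v list \<Rightarrow> bool" where
  "is_path G p \<longleftrightarrow> p \<noteq> [] \<and> distinct p \<and> set p \<subseteq> verts G \<and>
     (\<forall>i. Suc i < length p \<longrightarrow> {p ! i, p ! Suc i} \<in> edges G)"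

text \<open>A path to \<open>r\<close> may meet \<open>r\<close> before its last vertex, so that a vertex lying on \<open>r\<close> can
  dominate \<open>r\<close>; otherwise equivalent rays would not be dominated by the same vertices.\<close>

definition dominates :: "'v ugraph \<Rightarrow> 'v \<Rightarrow> (nat \<Rightarrow> 'v) \<Rightarrow> bool" where
  "dominates G v r \<longleftrightarrow> (\<exists>P. infinite P \<and>
     (\<forall>p\<in>P. is_path G p \<and> hd p = v \<and> last p \<in> range r) \<and>
     (\<forall>p\<in>P. \<forall>q\<in>P. p \<noteq> q \<longrightarrow> set p \<inter> set q = {v}))"

definition non_dominated :: "'v ugraph \<Rightarrow> (nat \<Rightarrow> 'v) \<Rightarrow> bool" where
  "non_dominated G r \<longleftrightarrow> \<not> (\<exists>v\<in>verts G. dominates G v r)"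

definition almost_non_dominated :: "'v ugraph \<Rightarrow> (nat \<Rightarrow> 'v) set \<Rightarrow> bool" where
  "almost_non_dominated G \<epsilon> \<longleftrightarrow> (\<exists>r\<in>\<epsilon>. non_dominated G r)"


section \<open>Topological ends\<close>

text \<open>Following Freudenthal (and Diestel and Kuehn), the sets of a chain are non-empty and
  connected. Without this the chain of empty sets would define an end, and so would the
  termwise union of two inequivalent chains.\<close>

definition end_chain :: "'a topology \<Rightarrow> (nat \<Rightarrow> 'a set) \<Rightarrow> bool" where
  "end_chain X A \<longleftrightarrow>
     (\<forall>n. openin X (A n) \<and> A n \<noteq> {} \<and> connectedin X (A n)) \<and>
     (\<forall>n. A (Suc n) \<subseteq> A n) \<and>
     (\<forall>n. compactin X (X frontier_of A n)) \<and>
     (\<Inter>n. X closure_of A n) = {}"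

definition end_chain_rel :: "'a topology \<Rightarrow> ((nat \<Rightarrow> 'a set) \<times> (nat \<Rightarrow> 'a set)) set" where
  "end_chain_rel X = {(A, B). end_chain X A \<and> end_chain X B \<and>
     (\<forall>n. \<exists>m k. B m \<subseteq> A n \<and> A k \<subseteq> B n)}"

definition topological_ends :: "'a topology \<Rightarrow> (nat \<Rightarrow> 'a set) set set" where
  "topological_ends X = {A. end_chain X A} // end_chain_rel X"


section \<open>A graph as a 1-complex\<close>

text \<open>Points are given by barycentric coordinates: \<open>segment_point u v t\<close> is the point
  \<open>(1 - t) u + t v\<close> of the edge \<open>uv\<close>, a copy of the unit interval.\<close>

definition vertex_point :: "'v \<Rightarrow> 'v \<Rightarrow> real" where
  "vertex_point v = indicator {v}"

definition segment_point :: "'v \<Rightarrow> 'v \<Rightarrow> real \<Rightarrow> 'v \<Rightarrow> real" where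
  "segment_point u v t = (\<lambda>w. (1 - t) * vertex_point u w + t * vertex_point v w)"

definition graph_points :: "'v ugraph \<Rightarrow> ('v \<Rightarrow> real) set" where
  "graph_points G = vertex_point ` verts G \<union>
     {segment_point u v t | u v t. {u, v} \<in> edges G \<and> t \<in> {0..1}}"

text \<open>The weak topology of the complex: a set is open iff its trace on every closed edge is
  open. At vertices of infinite degree this is neither the topology of pointwise convergence
  of coordinates nor a metric topology.\<close>

definition graph_topology :: "'v ugraph \<Rightarrow> ('v \<Rightarrow> real) topology" where
  "graph_topology G = topology (\<lambda>U. U \<subseteq> graph_points G \<and>
     (\<forall>u v. {u, v} \<in> edges G \<longrightarrow>
        openin (top_of_set {0..1}) {t \<in> {0..1}. segment_point u v t \<in> U}))"

lemma openin_graph_topology: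
  "openin (graph_topology G) U \<longleftrightarrow> U \<subseteq> graph_points G \<and>
     (\<forall>u v. {u, v} \<in> edges G \<longrightarrow>
        openin (top_of_set {0..1}) {t \<in> {0..1}. segment_point u v t \<in> U})"
proof -
  let ?tr = "\<lambda>u v U. {t \<in> {0..1::real}. segment_point u v t \<in> U}"
  let ?P = "\<lambda>U. U \<subseteq> graph_points G \<and>
     (\<forall>u v. {u, v} \<in> edges G \<longrightarrow> openin (top_of_set {0..1}) (?tr u v U))"
  have "istopology ?P"
    unfolding istopology_def
  proof (intro conjI allI impI)
    fix S T u v
    assume S: "?P S" and T: "?P T"
    show "S \<inter> T \<subseteq> graph_points G" using S by blast
    assume e: "{u, v} \<in> edges G"
    have "?tr u v (S \<inter> T) = ?tr u v S \<inter> ?tr u v T" by blast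
    then show "openin (top_of_set {0..1}) (?tr u v (S \<inter> T))"
      using S T e by (simp add: openin_Int)
  next
    fix K u v
    assume K: "\<forall>S\<in>K. ?P S"
    show "\<Union>K \<subseteq> graph_points G" using K by blast
    assume e: "{u, v} \<in> edges G"
    have "?tr u v (\<Union>K) = (\<Union>S\<in>K. ?tr u v S)" by blast
    moreover have "openin (top_of_set {0..1}) (\<Union>S\<in>K. ?tr u v S)"
      by (rule openin_Union) (use K e in blast)
    ultimately show "openin (top_of_set {0..1}) (?tr u v (\<Union>K))" by simp
  qed
  then show ?thesis
    by (simp add: graph_topology_def topology_inverse')
qed

lemma topspace_graph_topology: "topspace (graph_topology G) = graph_points G"
proof -
  have "{t \<in> {0..1}. segment_point u v t \<in> graph_points G} = {0..1}" if "{u, v} \<in> edges G" for u v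
    using that by (auto simp: graph_points_def)
  then have "openin (graph_topology G) (graph_points G)"
    by (simp add: openin_graph_topology)
  then show ?thesis
    by (meson openin_graph_topology openin_subset openin_topspace subset_antisym)
qed

text \<open>The map of Diestel and Kuehn: a topological end is sent to the unique end whose rays lie
  eventually, as sets of points, in every set of every chain representing it.\<close>

definition top_end_to_end :: "'v ugraph \<Rightarrow> (nat \<Rightarrow> ('v \<Rightarrow> real) set) set \<Rightarrow> (nat \<Rightarrow> 'v) set" where
  "top_end_to_end G \<tau> = (THE \<omega>. \<omega> \<in> ends G \<and>
     (\<forall>r\<in>\<omega>. \<forall>A\<in>\<tau>. \<forall>n. \<exists>T. is_tail T r \<and> graph_points T \<subseteq> A n))"

end

theory Submission
  imports Defs
begin

text \<open>The proof compares chains of open sets with rays. Every edge-end is the class of a ray, so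
  it suffices to show two things: every chain \<open>A\<close> representing a topological end has a
  non-dominated ray \<open>r\<close> that runs into it (a tail of \<open>r\<close>, edges included, lies in each \<open>A n\<close>),
  and every non-dominated ray runs into some chain. Moreover the class of \<open>A\<close> must be sent to
  the class of \<open>r\<close> whenever \<open>r\<close> runs into \<open>A\<close> (\<open>top_end_to_end_class\<close>). The image of the
  composed map is then the set of edge-ends of non-dominated rays.

  From a chain to a ray. A connected open set is connected along edges: two of its vertices
  are joined by a path all of whose edges lie inside it (\<open>reach_inside_connected_open\<close>). No set
  of a chain lies in a compact set, in particular not in an edge, so each contains a vertex.
  Joining a vertex of \<open>A n\<close> to one of \<open>A (Suc n)\<close> inside \<open>A n\<close>, for all \<open>n\<close>, gives an infinite
  walk that visits each vertex only finitely often, because the closures have empty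
  intersection; the walk contains a ray (\<open>ray_through_nested_relations\<close>).

  Compactness of the frontiers enters through one fact: in the weak topology a compact set
  meets the interiors of only finitely many edges and contains only finitely many vertices
  (\<open>finite_supports_of_compactin\<close>). The frontier of \<open>A n\<close> is thus carried by a finite vertex
  set \<open>X\<close>, and paths avoiding \<open>X\<close> cannot leave \<open>A n\<close>. Hence rays equivalent to \<open>r\<close> also run
  into \<open>A\<close>. A vertex \<open>v\<close> lies outside the closure of some \<open>A n\<close>, and a path of an infinite
  fan from \<open>v\<close> to \<open>r\<close> that avoids \<open>X - {v}\<close> would enter \<open>A n\<close> without crossing its frontier;
  so \<open>r\<close> is not dominated (\<open>non_dominated_if_runs_into\<close>).

  From a ray to a chain. If \<open>r\<close> is not dominated, every finite set \<open>X\<close> of vertices is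
  separated from a tail of \<open>r\<close> by a finite set disjoint from \<open>X\<close>: take the vertices outside \<open>X\<close>
  of maximal fans from \<open>X\<close> to \<open>r\<close>, which are finite (\<open>non_dominated_obtain_separator\<close>).
  Iterating from \<open>{r 0}\<close> gives finite sets \<open>X n\<close> and components \<open>C n\<close> of their complements that
  contain tails of \<open>r\<close>. The open stars of the \<open>C n\<close> form the required chain: their frontiers
  are supported in \<open>X n\<close>, and the vertices in all the closures are closed under adjacency,
  so that there are none (\<open>non_dominated_obtain_chain\<close>).\<close>


section \<open>Reachability and components\<close>

abbreviation reach :: "'v ugraph \<Rightarrow> 'v \<Rightarrow> 'v \<Rightarrow> bool" where
  "reach H \<equiv> (\<lambda>x y. {x, y} \<in> edges H)\<^sup>*\<^sup>*"

lemma reach_sym: "reach H u v \<Longrightarrow> reach H v u"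
  by (rule sympD[OF symp_rtranclp]) (auto simp: symp_def insert_commute)

lemma reach_mono: "reach H u v \<Longrightarrow> edges H \<subseteq> edges K \<Longrightarrow> reach K u v"
  by (induction rule: rtranclp_induct) (auto intro: rtranclp.rtrancl_into_rtrancl)

lemma simple_graph_edge:
  assumes "simple_graph G" "{u, v} \<in> edges G"
  shows "u \<in> verts G" "v \<in> verts G" "u \<noteq> v"
proof -
  obtain a b where "a \<in> verts G" "b \<in> verts G" "a \<noteq> b" "{u, v} = {a, b}"
    using assms unfolding simple_graph_def by blast
  then show "u \<in> verts G" "v \<in> verts G" "u \<noteq> v" by (auto simp: doubleton_eq_iff)
qed

lemma simple_graph_del_verts: "simple_graph G \<Longrightarrow> simple_graph (del_verts G X)"
  unfolding simple_graph_def
proof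
  fix e assume G: "\<forall>e\<in>edges G. \<exists>u v. u \<in> verts G \<and> v \<in> verts G \<and> u \<noteq> v \<and> e = {u, v}"
    and e: "e \<in> edges (del_verts G X)"
  then have "e \<in> edges G" "e \<inter> X = {}" by (simp_all add: del_verts_def)
  moreover from this(1) obtain u v where "u \<in> verts G" "v \<in> verts G" "u \<noteq> v" "e = {u, v}"
    using G by blast
  ultimately show "\<exists>u v. u \<in> verts (del_verts G X) \<and> v \<in> verts (del_verts G X) \<and> u \<noteq> v \<and> e = {u, v}"
    by (intro exI[of _ u] exI[of _ v]) (auto simp: del_verts_def)
qed

lemma simple_graph_del_edges: "simple_graph G \<Longrightarrow> simple_graph (del_edges G X)"
  unfolding simple_graph_def del_edges_def by simp

lemma reach_verts:
  assumes "simple_graph H" "reach H u v" "u \<in> verts H"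
  shows "v \<in> verts H"
  using assms(2,3) by induction (auto dest: simple_graph_edge[OF assms(1)])

definition component_of :: "'v ugraph \<Rightarrow> 'v \<Rightarrow> 'v ugraph" where
  "component_of H u = \<lparr>verts = {w. reach H u w}, edges = {e \<in> edges H. \<forall>w\<in>e. reach H u w}\<rparr>"

lemma connected_component_of:
  "connected_graph (component_of H u)"
proof -
  have *: "reach (component_of H u) u w" if "reach H u w" for w
    using that
  proof induction
    case (step y z)
    then have "reach H u z" by (meson rtranclp.rtrancl_into_rtrancl)
    with step have "{y, z} \<in> edges (component_of H u)" by (auto simp: component_of_def)
    with step.IH show ?case by (meson rtranclp.rtrancl_into_rtrancl)
  qed simp
  have "reach (component_of H u) a b" if "reach H u a" "reach H u b" for a b
    using *[OF that(1)] *[OF that(2)] reach_sym[of "component_of H u" u a] by (meson rtranclp_trans)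
  then show ?thesis
    unfolding connected_graph_def by (auto simp: component_of_def)
qed

lemma graph_component_component_of:
  assumes H: "simple_graph H" and u: "u \<in> verts H"
  shows "graph_component (component_of H u) H"
  unfolding graph_component_def
proof (intro conjI allI impI)
  have "\<exists>a b. reach H u a \<and> reach H u b \<and> a \<noteq> b \<and> e = {a, b}"
    if e: "e \<in> edges H" "\<forall>w\<in>e. reach H u w" for e
  proof -
    obtain a b where "a \<noteq> b" "e = {a, b}"
      using H e(1) unfolding simple_graph_def by blast
    with e(2) show ?thesis by auto
  qed
  then have "simple_graph (component_of H u)"
    unfolding simple_graph_def component_of_def by auto
  then show "subgraph (component_of H u) H"
    using reach_verts[OF H _ u] unfolding subgraph_def component_of_def by auto
  show "connected_graph (component_of H u)"
    by (rule connected_component_of)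
  fix D
  assume D: "subgraph D H \<and> connected_graph D \<and> subgraph (component_of H u) D"
  then have uD: "u \<in> verts D" by (auto simp: subgraph_def component_of_def)
  have "reach H u w" if "w \<in> verts D" for w
  proof -
    have "reach D u w" using D uD that unfolding connected_graph_def by blast
    then show ?thesis using D by (auto simp: subgraph_def elim: reach_mono)
  qed
  then have vD: "verts D \<subseteq> verts (component_of H u)" by (auto simp: component_of_def)
  moreover have "edges D \<subseteq> edges (component_of H u)"
  proof
    fix e assume e: "e \<in> edges D"
    moreover have "simple_graph D" "e \<in> edges H" using D e by (auto simp: subgraph_def)
    ultimately obtain a b where "e = {a, b}" "a \<in> verts D" "b \<in> verts D"
      unfolding simple_graph_def by blast
    with \<open>e \<in> edges H\<close> vD show "e \<in> edges (component_of H u)"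
      by (auto simp: component_of_def)
  qed
  ultimately show "D = component_of H u"
    using D unfolding subgraph_def by (intro ugraph.equality) auto
qed


section \<open>Tails of rays\<close>

definition tail_in :: "'v ugraph \<Rightarrow> (nat \<Rightarrow> 'v) \<Rightarrow> nat \<Rightarrow> bool" where
  "tail_in H r N \<longleftrightarrow> (\<forall>i\<ge>N. r i \<in> verts H \<and> {r i, r (Suc i)} \<in> edges H)"

definition tail_graph :: "(nat \<Rightarrow> 'v) \<Rightarrow> nat \<Rightarrow> 'v ugraph" where
  "tail_graph r N = \<lparr>verts = r ` {N..}, edges = (\<lambda>i. {r i, r (Suc i)}) ` {N..}\<rparr>"

lemma reach_ray_segment:
  assumes "N \<le> j" "\<And>i. N \<le> i \<Longrightarrow> {r i, r (Suc i)} \<in> edges H"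
  shows "reach H (r N) (r j)"
  using assms(1)
proof (induction j rule: dec_induct)
  case (step j)
  then show ?case using assms(2)[of j] by (meson rtranclp.rtrancl_into_rtrancl)
qed simp

lemma reach_tail:
  assumes "tail_in H r N" "N \<le> i" "N \<le> j"
  shows "reach H (r i) (r j)"
proof -
  have "reach H (r N) (r k)" if "N \<le> k" for k
    using reach_ray_segment[OF that] assms(1) unfolding tail_in_def by blast
  then show ?thesis using assms(2,3) reach_sym[of H "r N" "r i"] by (meson rtranclp_trans)
qed

lemma is_tail_tail_graph:
  assumes "inj r"
  shows "is_tail (tail_graph r N) r"
proof -
  have "simple_graph (tail_graph r N)"
    using injD[OF assms] unfolding simple_graph_def tail_graph_def
    by simp (metis atLeast_iff image_eqI le_SucI n_not_Suc_n)
  moreover have "connected_graph (tail_graph r N)"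
  proof -
    have "tail_in (tail_graph r N) r N" by (auto simp: tail_in_def tail_graph_def)
    from reach_tail[OF this] show ?thesis
      unfolding connected_graph_def by (auto simp: tail_graph_def)
  qed
  moreover have "infinite (r ` {N..})"
    using finite_imageD[of r "{N..}"] inj_on_subset[OF assms subset_UNIV] infinite_Ici by metis
  ultimately show ?thesis
    unfolding is_tail_def subgraph_def by (auto simp: tail_graph_def ray_graph_def)
qed

lemma is_tail_obtain_late:
  assumes "is_tail T r"
  obtains i where "N \<le> i" "r i \<in> verts T"
proof -
  have "verts T \<subseteq> range r" "infinite (verts T)"
    using assms by (auto simp: is_tail_def subgraph_def ray_graph_def)
  then have "\<not> verts T \<subseteq> r ` {..<N}" using finite_subset by blast
  then obtain x where x: "x \<in> verts T" "x \<notin> r ` {..<N}" by blast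
  obtain i where i: "x = r i" using x(1) \<open>verts T \<subseteq> range r\<close> by blast
  have "N \<le> i" using x(2) i by (meson imageI lessThan_iff not_le)
  moreover have "r i \<in> verts T" using x(1) i by simp
  ultimately show ?thesis by (rule that)
qed

text \<open>Once the two rays are known to run inside \<open>H\<close> from \<open>N\<close> and \<open>M\<close> on, the choice of the
  tails and of the component no longer matters: only the reachability of one ray from the
  other is left.\<close>

lemma tails_in_same_component_iff:
  assumes H: "simple_graph H" and r: "inj r" "tail_in H r N" and s: "inj s" "tail_in H s M"
  shows "tails_in_same_component H r s \<longleftrightarrow> reach H (r N) (s M)"
proof
  assume "tails_in_same_component H r s"
  then obtain C T S where C: "graph_component C H" and T: "is_tail T r" "subgraph T C"
    and S: "is_tail S s" "subgraph S C"
    unfolding tails_in_same_component_def by blast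
  obtain i where i: "N \<le> i" "r i \<in> verts T" using is_tail_obtain_late[OF T(1)] .
  obtain j where j: "M \<le> j" "s j \<in> verts S" using is_tail_obtain_late[OF S(1)] .
  have "connected_graph C" using C by (simp add: graph_component_def)
  moreover have "r i \<in> verts C" "s j \<in> verts C"
    using i j T S by (auto simp: subgraph_def)
  ultimately have "reach C (r i) (s j)" unfolding connected_graph_def by blast
  moreover have "edges C \<subseteq> edges H"
    using C by (auto simp: graph_component_def subgraph_def)
  ultimately have "reach H (r i) (s j)" by (rule reach_mono)
  then show "reach H (r N) (s M)"
    using reach_tail[OF r(2) order.refl i(1)] reach_tail[OF s(2) j(1) order.refl]
    by (meson rtranclp_trans)
next
  assume reach: "reach H (r N) (s M)"
  let ?C = "component_of H (r N)"
  have sub: "subgraph (tail_graph q K) ?C" if "inj q" "tail_in H q K" "reach H (r N) (q K)" for q K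
  proof -
    have "reach H (r N) (q i)" if "K \<le> i" for i
      using reach_tail[OF \<open>tail_in H q K\<close> order.refl that] \<open>reach H (r N) (q K)\<close>
      by (meson rtranclp_trans)
    with that(2) is_tail_tail_graph[OF that(1), of K] show ?thesis
      by (auto simp: subgraph_def tail_graph_def component_of_def tail_in_def is_tail_def)
  qed
  have "graph_component ?C H"
    using graph_component_component_of[OF H] r(2) by (auto simp: tail_in_def)
  with sub[OF r] sub[OF s reach] is_tail_tail_graph[OF r(1)] is_tail_tail_graph[OF s(1)]
  show "tails_in_same_component H r s"
    unfolding tails_in_same_component_def by blast
qed

lemma raysD:
  assumes "r \<in> rays G"
  shows "inj r" "r i \<in> verts G" "{r i, r (Suc i)} \<in> edges G"
  using assms unfolding rays_def by auto

lemma obtain_tail_in_del_verts: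
  assumes "r \<in> rays G" "finite X"
  obtains N where "tail_in (del_verts G X) r N"
proof -
  have "finite (r -` X)" by (rule finite_vimageI[OF assms(2) raysD(1)[OF assms(1)]])
  then obtain N where "\<forall>i\<in>r -` X. i < N"
    using finite_nat_set_iff_bounded[of "r -` X"] by auto
  then have "r i \<notin> X" if "N \<le> i" for i using that by (meson leD vimageI2)
  then have "tail_in (del_verts G X) r N"
    using raysD[OF assms(1)] by (auto simp: tail_in_def del_verts_def)
  with that show ?thesis .
qed

text \<open>An edge with no end in common with the edges in \<open>X\<close> is not in \<open>X\<close>. If \<open>X\<close> is finite, only
  finitely many ends are involved, so statements about deleted edges reduce to statements about
  deleted vertices.\<close>

lemma edges_del_verts_Union_subset:
  assumes "simple_graph G"
  shows "edges (del_verts G (\<Union>X)) \<subseteq> edges (del_edges G X)"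
proof
  fix e assume e: "e \<in> edges (del_verts G (\<Union>X))"
  then have "e \<noteq> {}" using assms by (auto simp: simple_graph_def del_verts_def)
  with e show "e \<in> edges (del_edges G X)" by (auto simp: del_verts_def del_edges_def)
qed


section \<open>Ends and edge-ends as quotients\<close>

lemma tail_in_mono:
  "tail_in H r N \<Longrightarrow> verts H \<subseteq> verts K \<Longrightarrow> edges H \<subseteq> edges K \<Longrightarrow> tail_in K r N"
  unfolding tail_in_def by blast

lemma finite_Union_edges:
  assumes "simple_graph G" "finite X" "X \<subseteq> edges G"
  shows "finite (\<Union>X)"
proof (rule finite_Union[OF assms(2)])
  fix e assume "e \<in> X"
  then have "e \<in> edges G" using assms(3) by blast
  then obtain u v where "e = {u, v}" using assms(1) unfolding simple_graph_def by blast
  then show "finite e" by simp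
qed

lemma obtain_tail_in_del_edges:
  assumes "simple_graph G" "r \<in> rays G" "finite X" "X \<subseteq> edges G"
  obtains N where "tail_in (del_edges G X) r N"
proof -
  obtain N where N: "tail_in (del_verts G (\<Union>X)) r N"
    using obtain_tail_in_del_verts[OF assms(2) finite_Union_edges[OF assms(1,3,4)]] .
  have "tail_in (del_edges G X) r N"
    by (rule tail_in_mono[OF N _ edges_del_verts_Union_subset[OF assms(1)]])
      (auto simp: del_verts_def del_edges_def)
  with that show ?thesis .
qed

text \<open>Ends and edge-ends differ only in the family of subgraphs in which tails have to be
  joined. That every ray has a tail in each of these subgraphs is what makes the relation
  reflexive, and also transitive: two tails of the middle ray are joined to each other.\<close>

lemma equiv_joined_tails:
  assumes simple: "\<And>H. H \<in> \<H> \<Longrightarrow> simple_graph H"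
    and tail: "\<And>H r. H \<in> \<H> \<Longrightarrow> r \<in> R \<Longrightarrow> \<exists>N. tail_in H r N"
    and inj: "\<And>r. r \<in> R \<Longrightarrow> inj r"
  shows "equiv R {(r, s). r \<in> R \<and> s \<in> R \<and> (\<forall>H\<in>\<H>. tails_in_same_component H r s)}"
    (is "equiv R ?E")
proof (rule equivI)
  have key: "tails_in_same_component H r s \<longleftrightarrow> reach H (r N) (s M)"
    if "H \<in> \<H>" "r \<in> R" "s \<in> R" "tail_in H r N" "tail_in H s M" for H r s N M
    using tails_in_same_component_iff[OF simple[OF that(1)] inj[OF that(2)] that(4) inj[OF that(3)] that(5)] .
  show "?E \<subseteq> R \<times> R" by blast
  show "refl_on R ?E"
  proof (rule refl_onI, clarsimp)
    fix r H assume H: "r \<in> R" "H \<in> \<H>"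
    then obtain N where N: "tail_in H r N" using tail by blast
    show "tails_in_same_component H r r" using key[OF H(2,1,1) N N] by simp
  qed
  show "sym ?E"
  proof (rule symI, clarsimp)
    fix r s H assume H: "r \<in> R" "s \<in> R" "H \<in> \<H>" and "\<forall>H\<in>\<H>. tails_in_same_component H r s"
    then have rs: "tails_in_same_component H r s" by blast
    obtain N where N: "tail_in H r N" using tail[OF H(3,1)] ..
    obtain M where M: "tail_in H s M" using tail[OF H(3,2)] ..
    show "tails_in_same_component H s r"
      using rs key[OF H(3,1,2) N M] key[OF H(3,2,1) M N] reach_sym[of H "r N" "s M"] by blast
  qed
  show "trans ?E"
  proof (rule transI, clarsimp)
    fix r s t H
    assume H: "r \<in> R" "s \<in> R" "t \<in> R" "H \<in> \<H>" and "\<forall>H\<in>\<H>. tails_in_same_component H r s"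
      "\<forall>H\<in>\<H>. tails_in_same_component H s t"
    then have rs: "tails_in_same_component H r s" "tails_in_same_component H s t" by blast+
    obtain N where N: "tail_in H r N" using tail[OF H(4,1)] ..
    obtain M where M: "tail_in H s M" using tail[OF H(4,2)] ..
    obtain K where K: "tail_in H t K" using tail[OF H(4,3)] ..
    have "reach H (r N) (s M)" "reach H (s M) (t K)"
      using rs key[OF H(4,1,2) N M] key[OF H(4,2,3) M K] by blast+
    then have "reach H (r N) (t K)" by (rule rtranclp_trans)
    then show "tails_in_same_component H r t" using key[OF H(4,1,3) N K] by blast
  qed
qed

lemma equiv_end_rel:
  assumes "simple_graph G"
  shows "equiv (rays G) (end_rel G)"
proof -
  let ?H = "del_verts G ` {X. finite X \<and> X \<subseteq> verts G}"
  have "equiv (rays G) {(r, s). r \<in> rays G \<and> s \<in> rays G \<and> (\<forall>H\<in>?H. tails_in_same_component H r s)}"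
  proof (rule equiv_joined_tails)
    show "\<exists>N. tail_in H r N" if "H \<in> ?H" "r \<in> rays G" for H r
      using that obtain_tail_in_del_verts[OF that(2)] by blast
  qed (auto simp: simple_graph_del_verts assms raysD)
  moreover have "end_rel G = {(r, s). r \<in> rays G \<and> s \<in> rays G \<and> (\<forall>H\<in>?H. tails_in_same_component H r s)}"
    unfolding end_rel_def by auto
  ultimately show ?thesis by simp
qed

lemma equiv_edge_end_rel:
  assumes "simple_graph G"
  shows "equiv (rays G) (edge_end_rel G)"
proof -
  let ?H = "del_edges G ` {X. finite X \<and> X \<subseteq> edges G}"
  have "equiv (rays G) {(r, s). r \<in> rays G \<and> s \<in> rays G \<and> (\<forall>H\<in>?H. tails_in_same_component H r s)}"
  proof (rule equiv_joined_tails)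
    show "\<exists>N. tail_in H r N" if "H \<in> ?H" "r \<in> rays G" for H r
      using that obtain_tail_in_del_edges[OF assms that(2)] by blast
  qed (auto simp: simple_graph_del_edges assms raysD)
  moreover have "edge_end_rel G = {(r, s). r \<in> rays G \<and> s \<in> rays G \<and> (\<forall>H\<in>?H. tails_in_same_component H r s)}"
    unfolding edge_end_rel_def by auto
  ultimately show ?thesis by simp
qed

lemma end_relI:
  assumes "simple_graph G" "r \<in> rays G" "s \<in> rays G"
    and "\<And>X N M. finite X \<Longrightarrow> X \<subseteq> verts G \<Longrightarrow> tail_in (del_verts G X) r N \<Longrightarrow>
      tail_in (del_verts G X) s M \<Longrightarrow> reach (del_verts G X) (r N) (s M)"
  shows "(r, s) \<in> end_rel G"
proof -
  have "tails_in_same_component (del_verts G X) r s" if X: "finite X" "X \<subseteq> verts G" for X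
  proof -
    obtain N where N: "tail_in (del_verts G X) r N" using obtain_tail_in_del_verts[OF assms(2) X(1)] .
    obtain M where M: "tail_in (del_verts G X) s M" using obtain_tail_in_del_verts[OF assms(3) X(1)] .
    show ?thesis
      using tails_in_same_component_iff[OF simple_graph_del_verts[OF assms(1)] raysD(1)[OF assms(2)] N
          raysD(1)[OF assms(3)] M] assms(4)[OF X N M] by blast
  qed
  with assms(2,3) show ?thesis by (simp add: end_rel_def)
qed

lemma end_relD:
  assumes "simple_graph G" "(r, s) \<in> end_rel G" "finite X" "X \<subseteq> verts G"
    "tail_in (del_verts G X) r N" "tail_in (del_verts G X) s M"
  shows "reach (del_verts G X) (r N) (s M)"
proof -
  have rs: "r \<in> rays G" "s \<in> rays G" "tails_in_same_component (del_verts G X) r s"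
    using assms(2-4) by (auto simp: end_rel_def)
  show ?thesis
    using tails_in_same_component_iff[OF simple_graph_del_verts[OF assms(1)] raysD(1)[OF rs(1)] assms(5)
          raysD(1)[OF rs(2)] assms(6)] rs(3) by blast
qed

lemma end_rel_subset_edge_end_rel:
  assumes G: "simple_graph G"
  shows "end_rel G \<subseteq> edge_end_rel G"
proof clarify
  fix r s assume rs: "(r, s) \<in> end_rel G"
  then have ray: "r \<in> rays G" "s \<in> rays G" by (auto simp: end_rel_def)
  have "tails_in_same_component (del_edges G X) r s" if X: "finite X" "X \<subseteq> edges G" for X
  proof -

    have fin: "finite (\<Union>X)" by (rule finite_Union_edges[OF G X])
    have sub: "\<Union>X \<subseteq> verts G"
    proof clarify
      fix x e assume "e \<in> X" "x \<in> e"
      moreover from this X have "e \<in> edges G" by blast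
      then obtain u v where "u \<in> verts G" "v \<in> verts G" "e = {u, v}"
        using G unfolding simple_graph_def by blast
      ultimately show "x \<in> verts G" by auto
    qed
    let ?H = "del_verts G (\<Union>X)" and ?K = "del_edges G X"
    obtain N where N: "tail_in ?H r N" using obtain_tail_in_del_verts[OF ray(1) fin] .
    obtain M where M: "tail_in ?H s M" using obtain_tail_in_del_verts[OF ray(2) fin] .
    have eHK: "edges ?H \<subseteq> edges ?K" by (rule edges_del_verts_Union_subset[OF G])
    have vHK: "verts ?H \<subseteq> verts ?K" by (auto simp: del_verts_def del_edges_def)
    have "reach ?H (r N) (s M)" by (rule end_relD[OF G rs fin sub N M])
    then have "reach ?K (r N) (s M)" using eHK by (rule reach_mono)
    then show ?thesis
      using tails_in_same_component_iff[OF simple_graph_del_edges[OF G]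
          raysD(1)[OF ray(1)] tail_in_mono[OF N vHK eHK] raysD(1)[OF ray(2)] tail_in_mono[OF M vHK eHK]]
      by blast
  qed
  then show "(r, s) \<in> edge_end_rel G" using ray by (simp add: edge_end_rel_def)
qed

lemma end_to_edge_end_class:
  assumes G: "simple_graph G" and r: "r \<in> rays G"
  shows "end_to_edge_end G (end_rel G `` {r}) = edge_end_rel G `` {r}"
proof -
  have "edge_end_rel G `` {s} = edge_end_rel G `` {r}" if "(r, s) \<in> end_rel G" for s
  proof -
    have "(r, s) \<in> edge_end_rel G" using that end_rel_subset_edge_end_rel[OF G] by blast
    then show ?thesis by (rule equiv_class_eq[OF equiv_edge_end_rel[OF G], symmetric])
  qed
  moreover have "(r, r) \<in> end_rel G"
    using equiv_end_rel[OF G] r by (meson equivE refl_onD)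
  ultimately show ?thesis unfolding end_to_edge_end_def by blast
qed


section \<open>Points, supports and the weak topology\<close>

text \<open>The support of a point is the carrier cell of the complex: a vertex, or the two ends of
  the edge whose interior contains the point. It reduces topological questions to questions
  about finite vertex sets.\<close>

definition point_support :: "('v \<Rightarrow> real) \<Rightarrow> 'v set" where
  "point_support x = {w. x w \<noteq> 0}"

lemma vertex_point_apply: "vertex_point u w = (if w = u then 1 else 0)"
  by (simp add: vertex_point_def)

lemma segment_point_apply:
  "segment_point u v t w = (1 - t) * (if w = u then 1 else 0) + t * (if w = v then 1 else 0)"
  by (simp add: segment_point_def vertex_point_apply)

lemma segment_point_0 [simp]: "segment_point u v 0 = vertex_point u"
  and segment_point_1 [simp]: "segment_point u v 1 = vertex_point v"
  by (simp_all add: segment_point_def fun_eq_iff)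

lemma segment_point_swap: "segment_point v u t = segment_point u v (1 - t)"
  by (simp add: segment_point_def fun_eq_iff)

lemma vertex_point_eq_iff [simp]: "vertex_point u = vertex_point v \<longleftrightarrow> u = v"
  by (auto simp: fun_eq_iff vertex_point_apply split: if_splits)

lemma point_support_vertex_point [simp]: "point_support (vertex_point w) = {w}"
  by (auto simp: point_support_def vertex_point_apply)

lemma point_support_segment_point: "point_support (segment_point u v t) \<subseteq> {u, v}"
  by (auto simp: point_support_def segment_point_apply split: if_splits)

lemma vertex_point_eq_segment_point:
  assumes "vertex_point w = segment_point u v t" "u \<noteq> v"
  shows "w = u \<and> t = 0 \<or> w = v \<and> t = 1"
proof -
  have "w \<in> {u, v}"
    using point_support_segment_point[of u v t] assms(1)[symmetric] by simp
  then consider "w = u" | "w = v" by blast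
  then show ?thesis
  proof cases
    case 1
    then show ?thesis using fun_cong[OF assms(1), of v] assms(2)
      by (simp add: segment_point_apply vertex_point_apply)
  next
    case 2
    then show ?thesis using fun_cong[OF assms(1), of u] assms(2)
      by (simp add: segment_point_apply vertex_point_apply)
  qed
qed

text \<open>Edges meet only in vertices, and an interior point determines its parameter up to the
  orientation of the edge.\<close>

lemma inner_segment_point_eq:
  assumes eq: "segment_point a b s = segment_point u v t" and s: "0 < s" "s < 1" and ne: "a \<noteq> b" "u \<noteq> v"
  shows "a = u \<and> b = v \<and> s = t \<or> a = v \<and> b = u \<and> s = 1 - t"
proof -
  have a: "segment_point u v t a = 1 - s" and b: "segment_point u v t b = s"
    using eq[symmetric] ne(1) by (simp_all add: segment_point_apply)
  have "a \<in> point_support (segment_point u v t)" "b \<in> point_support (segment_point u v t)"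
    using a b s by (simp_all add: point_support_def)
  then have "a \<in> {u, v}" "b \<in> {u, v}" using point_support_segment_point[of u v t] by blast+
  then consider "a = u" "b = v" | "a = v" "b = u" using ne(1) by blast
  then show ?thesis
    using a b ne by cases (simp_all add: segment_point_apply)
qed

lemma graph_points_cases:
  assumes G: "simple_graph G" and x: "x \<in> graph_points G"
  obtains w where "w \<in> verts G" "x = vertex_point w"
  | u v t where "{u, v} \<in> edges G" "0 < t" "t < 1" "x = segment_point u v t"
proof -
  from x consider w where "w \<in> verts G" "x = vertex_point w"
    | u v t where "{u, v} \<in> edges G" "0 \<le> t" "t \<le> 1" "x = segment_point u v t"
    unfolding graph_points_def by auto
  then show thesis
  proof cases
    case (2 u v t)
    note uv = simple_graph_edge[OF G 2(1)]
    consider "t = 0" | "t = 1" | "0 < t" "t < 1" using 2 by linarith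
    then show thesis
      using 2 uv that by cases auto
  qed (use that in blast)
qed

lemma vertex_point_in_graph_points: "w \<in> verts G \<Longrightarrow> vertex_point w \<in> graph_points G"
  by (simp add: graph_points_def)

lemma segment_point_in_graph_points:
  "{u, v} \<in> edges G \<Longrightarrow> t \<in> {0..1} \<Longrightarrow> segment_point u v t \<in> graph_points G"
  unfolding graph_points_def by blast

lemma point_support_nonempty:
  assumes "simple_graph G" "x \<in> graph_points G"
  shows "point_support x \<noteq> {}"
  using assms
proof (cases rule: graph_points_cases)
  case (2 u v t)
  then have "v \<in> point_support x"
    using simple_graph_edge(3)[OF assms(1) 2(1)] by (simp add: point_support_def segment_point_apply)
  then show ?thesis by blast
qed simp

lemma point_support_subset_verts:
  assumes "simple_graph G" "x \<in> graph_points G"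
  shows "point_support x \<subseteq> verts G"
  using assms
proof (cases rule: graph_points_cases)
  case (2 u v t)
  then show ?thesis
    using point_support_segment_point[of u v t] simple_graph_edge[OF assms(1) 2(1)] by blast
qed simp

lemma continuous_map_segment_point:
  assumes "{u, v} \<in> edges G"
  shows "continuous_map (top_of_set {0..1}) (graph_topology G) (segment_point u v)"
  unfolding continuous_map_def
proof (intro conjI allI impI)
  show "segment_point u v \<in> topspace (top_of_set {0..1}) \<rightarrow> topspace (graph_topology G)"
    using segment_point_in_graph_points[OF assms] by (auto simp: topspace_graph_topology)
  fix U assume "openin (graph_topology G) U"
  then show "openin (top_of_set {0..1}) {x \<in> topspace (top_of_set {0..1}). segment_point u v x \<in> U}"
    using assms by (simp add: openin_graph_topology)
qed

lemma compactin_edge: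
  "{u, v} \<in> edges G \<Longrightarrow> compactin (graph_topology G) (segment_point u v ` {0..1})"
  by (rule image_compactin[OF _ continuous_map_segment_point]) (auto simp: compactin_subtopology)

lemma connectedin_edge_part:
  assumes "{u, v} \<in> edges G" "I \<subseteq> {0..1}" "connected I"
  shows "connectedin (graph_topology G) (segment_point u v ` I)"
  by (rule connectedin_continuous_map_image[OF continuous_map_segment_point[OF assms(1)]])
    (use assms in \<open>simp add: connectedin_subtopology\<close>)

definition open_star :: "'v ugraph \<Rightarrow> 'v set \<Rightarrow> ('v \<Rightarrow> real) set" where
  "open_star G W = {x \<in> graph_points G. point_support x \<inter> W \<noteq> {}}"

lemma openin_open_star: "openin (graph_topology G) (open_star G W)"
  unfolding openin_graph_topology
proof (intro conjI allI impI)
  show "open_star G W \<subseteq> graph_points G" by (auto simp: open_star_def)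
  fix u v assume e: "{u, v} \<in> edges G"
  let ?U = "\<lambda>w. {t \<in> {0..1}. segment_point u v t w \<in> - {0}}"
  have "continuous_on {0..1} (\<lambda>t. segment_point u v t w)" for w
    unfolding segment_point_apply by (intro continuous_intros)
  then have "openin (top_of_set {0..1}) (?U w)" for w
    using continuous_openin_preimage_gen[of "{0..1}" "\<lambda>t. segment_point u v t w" "- {0}"]
    by (simp add: vimage_def Int_def open_Compl)
  then have "openin (top_of_set {0..1}) (\<Union>w\<in>W. ?U w)" by blast
  moreover have "{t \<in> {0..1}. segment_point u v t \<in> open_star G W} = (\<Union>w\<in>W. ?U w)"
    using segment_point_in_graph_points[OF e] by (auto simp: open_star_def point_support_def)
  ultimately show "openin (top_of_set {0..1}) {t \<in> {0..1}. segment_point u v t \<in> open_star G W}"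
    by simp
qed

text \<open>The points supported in \<open>W\<close> form the subcomplex spanned by \<open>W\<close>.\<close>

lemma closedin_supported:
  "closedin (graph_topology G) {x \<in> graph_points G. point_support x \<subseteq> W}"
proof -
  have "graph_points G - {x \<in> graph_points G. point_support x \<subseteq> W} = open_star G (- W)"
    by (auto simp: open_star_def)
  then show ?thesis
    using openin_open_star[of G "- W"] by (auto simp: closedin_def topspace_graph_topology)
qed

lemma compactin_supported:
  assumes G: "simple_graph G" and W: "finite W"
  shows "compactin (graph_topology G) {x \<in> graph_points G. point_support x \<subseteq> W}"
proof -
  let ?S = "{x \<in> graph_points G. point_support x \<subseteq> W}"
  let ?P = "{(u, v) \<in> W \<times> W. {u, v} \<in> edges G}"
  let ?K = "vertex_point ` (W \<inter> verts G) \<union> (\<Union>(u, v)\<in>?P. segment_point u v ` {0..1})"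
  have "compactin (graph_topology G) (vertex_point ` (W \<inter> verts G))"
    using W by (intro finite_imp_compactin) (auto simp: topspace_graph_topology vertex_point_in_graph_points)
  moreover have "finite ?P" using W by (rule_tac finite_subset[of _ "W \<times> W"]) auto
  then have "compactin (graph_topology G) (\<Union>(u, v)\<in>?P. segment_point u v ` {0..1})"
    by (intro compactin_Union) (auto intro: compactin_edge)
  ultimately have K: "compactin (graph_topology G) ?K" by (rule compactin_Un)
  have "x \<in> ?K" if x: "x \<in> graph_points G" "point_support x \<subseteq> W" for x
    using G x(1)
  proof (cases rule: graph_points_cases)
    case (2 u v t)
    then have "u \<in> point_support x" "v \<in> point_support x"
      using simple_graph_edge(3)[OF G 2(1)] by (simp_all add: point_support_def segment_point_apply)
    then have "(u, v) \<in> ?P" using 2 x(2) by blast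
    moreover have "x \<in> segment_point u v ` {0..1}" using 2 by simp
    ultimately show ?thesis by blast
  qed (use x in auto)
  then have "?S \<subseteq> ?K" by blast
  then show ?thesis using closed_compactin[OF K _ closedin_supported] by blast
qed

text \<open>A set with at most one point of each support meets every edge in finitely many points, and
  is therefore closed together with all its subsets. A compact set contains no infinite set of
  this kind.\<close>

lemma finite_supports_of_compactin:
  assumes G: "simple_graph G" and K: "compactin (graph_topology G) K"
  shows "finite (point_support ` K)"
proof (rule ccontr)
  assume inf: "infinite (point_support ` K)"
  obtain S where S: "S \<subseteq> K" "inj_on point_support S" "point_support ` K = point_support ` S"
    using subset_image_inj[of "point_support ` K" point_support K] by auto
  have KX: "K \<subseteq> graph_points G"
    using compactin_subset_topspace[OF K] by (simp add: topspace_graph_topology)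
  have op: "openin (graph_topology G) (graph_points G - T)" if T: "T \<subseteq> S" for T
    unfolding openin_graph_topology
  proof (intro conjI allI impI)
    fix u v assume e: "{u, v} \<in> edges G"
    note uv = simple_graph_edge(3)[OF G e]
    let ?I = "{t \<in> {0..1}. segment_point u v t \<in> T}"
    have "inj_on (\<lambda>t. point_support (segment_point u v t)) ?I"
    proof (rule inj_onI)
      fix s t assume st: "s \<in> ?I" "t \<in> ?I"
        and eq: "point_support (segment_point u v s) = point_support (segment_point u v t)"
      have "segment_point u v s \<in> S" "segment_point u v t \<in> S" using st T by auto
      then have "segment_point u v s = segment_point u v t" using inj_onD[OF S(2), of "segment_point u v s" "segment_point u v t"] eq by blast
      then have "segment_point u v s v = segment_point u v t v" by simp
      then show "s = t" using uv by (simp add: segment_point_apply)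
    qed
    moreover have "finite ((\<lambda>t. point_support (segment_point u v t)) ` ?I)"
    proof (rule finite_subset)
      show "(\<lambda>t. point_support (segment_point u v t)) ` ?I \<subseteq> Pow {u, v}"
        by (intro image_subsetI PowI point_support_segment_point)
    qed simp
    ultimately have "finite ?I" by (rule finite_imageD[rotated])
    then have "openin (top_of_set {0..1}) ({0..1} - ?I)"
      by (intro openin_diff closed_subset finite_imp_closed) auto
    moreover have "{t \<in> {0..1}. segment_point u v t \<in> graph_points G - T} = {0..1} - ?I"
      using segment_point_in_graph_points[OF e] by auto
    ultimately show "openin (top_of_set {0..1}) {t \<in> {0..1}. segment_point u v t \<in> graph_points G - T}"
      by simp
  qed auto
  \<comment> \<open>This cover has no finite subcover, since each of its sets contains just one point of \<open>S\<close>.\<close>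
  let ?U = "\<lambda>x. graph_points G - (S - {x})"
  have "S \<noteq> {}" using inf S(3) by auto
  then have "K \<subseteq> \<Union>(?U ` S)" using KX by blast
  moreover have "\<And>U. U \<in> ?U ` S \<Longrightarrow> openin (graph_topology G) U" using op by blast
  ultimately obtain F where F: "finite F" "F \<subseteq> ?U ` S" "K \<subseteq> \<Union>F"
    using compactinD[OF K, of "?U ` S"] by blast
  from finite_subset_image[OF F(1,2)] obtain B where B: "B \<subseteq> S" "finite B" "F = ?U ` B" by blast
  have "S \<subseteq> B"
  proof
    fix x assume x: "x \<in> S"
    then obtain b where "b \<in> B" "x \<in> ?U b" using F(3) B(3) S(1) by blast
    then show "x \<in> B" using x by blast
  qed
  then have "finite (point_support ` S)" using B(2) by (meson finite_imageI finite_subset)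
  with inf S(3) show False by simp
qed

corollary finite_support_vertices_of_compactin:
  assumes G: "simple_graph G" and K: "compactin (graph_topology G) K"
  shows "finite (\<Union>(point_support ` K))"
proof (rule finite_Union[OF finite_supports_of_compactin[OF assms]], clarify)
  fix x assume "x \<in> K"
  then have "x \<in> graph_points G"
    using compactin_subset_topspace[OF K] by (auto simp: topspace_graph_topology)
  with G show "finite (point_support x)"
  proof (cases rule: graph_points_cases)
    case (2 u v t)
    then show ?thesis by (auto intro: finite_subset[OF point_support_segment_point])
  qed simp
qed


section \<open>Connected open sets of points\<close>

definition edge_inside :: "'v ugraph \<Rightarrow> ('v \<Rightarrow> real) set \<Rightarrow> 'v \<Rightarrow> 'v \<Rightarrow> bool" where
  "edge_inside G A x y \<longleftrightarrow> {x, y} \<in> edges G \<and> segment_point x y ` {0..1} \<subseteq> A"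

lemma edge_insideD:
  assumes "edge_inside G A x y"
  shows "{x, y} \<in> edges G" "vertex_point x \<in> A" "vertex_point y \<in> A"
proof -
  have "segment_point x y 0 \<in> A" "segment_point x y 1 \<in> A" "{x, y} \<in> edges G"
    using assms unfolding edge_inside_def by (auto simp del: segment_point_0 segment_point_1)
  then show "{x, y} \<in> edges G" "vertex_point x \<in> A" "vertex_point y \<in> A" by simp_all
qed

lemma openin_if_closed_along_edges:
  assumes A: "openin (graph_topology G) A" and U: "U \<subseteq> A"
    and along: "\<And>u v s t. {u, v} \<in> edges G \<Longrightarrow> s \<in> {0..1} \<Longrightarrow> t \<in> {0..1} \<Longrightarrow>
      segment_point u v ` closed_segment s t \<subseteq> A \<Longrightarrow> segment_point u v s \<in> U \<Longrightarrow> segment_point u v t \<in> U"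
  shows "openin (graph_topology G) U"
  unfolding openin_graph_topology
proof (intro conjI allI impI)
  show "U \<subseteq> graph_points G" using A U by (auto simp: openin_graph_topology)
  fix u v assume e: "{u, v} \<in> edges G"
  let ?A = "{t \<in> {0..1}. segment_point u v t \<in> A}" and ?U = "{t \<in> {0..1}. segment_point u v t \<in> U}"
  have opA: "openin (top_of_set {0..1}) ?A" using A e by (simp add: openin_graph_topology)
  show "openin (top_of_set {0..1}) ?U"
    unfolding openin_euclidean_subtopology_iff
  proof (intro conjI ballI)
    fix s assume s: "s \<in> ?U"
    then have "s \<in> ?A" using U by auto
    then obtain d where d: "d > 0" "\<And>t. t \<in> {0..1} \<Longrightarrow> dist t s < d \<Longrightarrow> t \<in> ?A"
      using opA unfolding openin_euclidean_subtopology_iff by blast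
    have "t \<in> ?U" if t: "t \<in> {0..1}" "dist t s < d" for t
    proof -
      have "p \<in> ?A" if "p \<in> closed_segment s t" for p
      proof (rule d(2))
        show "p \<in> {0..1}"
          using that s t(1) by (auto simp: closed_segment_eq_real_ivl split: if_splits)
        show "dist p s < d"
          using that t(2) by (auto simp: closed_segment_eq_real_ivl dist_real_def split: if_splits)
      qed
      then have seg: "segment_point u v ` closed_segment s t \<subseteq> A" by blast
      have "s \<in> {0..1}" "segment_point u v s \<in> U" using s by auto
      with along[OF e _ t(1) seg] t(1) show ?thesis by blast
    qed
    then show "\<exists>d>0. \<forall>t\<in>{0..1}. dist t s < d \<longrightarrow> t \<in> ?U" using d(1) by blast
  qed auto
qed

text \<open>Openness in the weak topology is tested edge by edge, so a part of \<open>A\<close> that is left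
  along no edge is open, and so is the rest of \<open>A\<close>.\<close>

lemma connected_open_eq_if_closed_along_edges:
  assumes A: "openin (graph_topology G) A" "connectedin (graph_topology G) A"
    and U: "U \<subseteq> A" "U \<noteq> {}"
    and along: "\<And>u v s t. {u, v} \<in> edges G \<Longrightarrow> s \<in> {0..1} \<Longrightarrow> t \<in> {0..1} \<Longrightarrow>
      segment_point u v ` closed_segment s t \<subseteq> A \<Longrightarrow> segment_point u v s \<in> U \<Longrightarrow> segment_point u v t \<in> U"
  shows "U = A"
proof (rule ccontr)
  assume "U \<noteq> A"
  have "openin (graph_topology G) (A - U)"
  proof (rule openin_if_closed_along_edges[OF A(1)])
    fix u v and s t :: real
    assume e: "{u, v} \<in> edges G" and st: "s \<in> {0..1}" "t \<in> {0..1}"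
      and seg: "segment_point u v ` closed_segment s t \<subseteq> A" and s: "segment_point u v s \<in> A - U"
    have "segment_point u v t \<notin> U"
      using along[OF e st(2,1)] seg s by (auto simp: closed_segment_commute)
    then show "segment_point u v t \<in> A - U" using seg by auto
  qed auto
  moreover have "openin (graph_topology G) U"
    by (rule openin_if_closed_along_edges[OF A(1) U(1) along])
  moreover have "A \<subseteq> U \<union> (A - U)" "U \<inter> (A - U) \<inter> A = {}" "U \<inter> A \<noteq> {}" "(A - U) \<inter> A \<noteq> {}"
    using U \<open>U \<noteq> A\<close> by auto
  ultimately show False using A(2) unfolding connectedin by blast
qed

text \<open>The part of \<open>A\<close> that can be reached from \<open>a\<close> by full edges inside \<open>A\<close>, followed by an
  initial piece of one more edge, is left along no edge, and hence is all of \<open>A\<close>.\<close>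

lemma reach_inside_connected_open:
  assumes G: "simple_graph G" and A: "openin (graph_topology G) A" "connectedin (graph_topology G) A"
    and a: "vertex_point a \<in> A" and b: "vertex_point b \<in> A"
  shows "(edge_inside G A)\<^sup>*\<^sup>* a b"
proof -
  let ?W = "{w. (edge_inside G A)\<^sup>*\<^sup>* a w}"
  \<comment> \<open>The first alternative is for \<open>a\<close> itself, which may be isolated.\<close>
  define U where "U = {x \<in> A. \<exists>w\<in>?W. x = vertex_point w \<or> (\<exists>z t. {w, z} \<in> edges G \<and> t \<in> {0..1} \<and>
    x = segment_point w z t \<and> segment_point w z ` {0..t} \<subseteq> A)}"
  have vertex: "c \<in> ?W" if "vertex_point c \<in> U" for c
  proof -
    from that obtain w where w: "w \<in> ?W" and "vertex_point c = vertex_point w \<or>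
        (\<exists>z t. {w, z} \<in> edges G \<and> t \<in> {0..1} \<and>
          vertex_point c = segment_point w z t \<and> segment_point w z ` {0..t} \<subseteq> A)"
      unfolding U_def by auto
    then consider "vertex_point c = vertex_point w"
      | z t where "{w, z} \<in> edges G" "vertex_point c = segment_point w z t" "segment_point w z ` {0..t} \<subseteq> A"
      by blast
    then show ?thesis
    proof cases
      case (2 z t)
      from vertex_point_eq_segment_point[OF 2(2) simple_graph_edge(3)[OF G 2(1)]]
      consider "c = w" | "c = z" "t = 1" by blast
      then show ?thesis
      proof cases
        case c: 2
        with 2 have "edge_inside G A w c" by (simp add: edge_inside_def)
        with w show ?thesis by (auto intro: rtranclp.rtrancl_into_rtrancl)
      qed (use w in simp)
    qed (use w in simp)
  qed
  have "U = A"
  proof (rule connected_open_eq_if_closed_along_edges[OF A])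
    show "U \<subseteq> A" by (auto simp: U_def)
    have "vertex_point a \<in> U" using a by (auto simp: U_def)
    then show "U \<noteq> {}" by blast
    fix u v and s t :: real
    assume e: "{u, v} \<in> edges G" and st: "s \<in> {0..1}" "t \<in> {0..1}"
      and seg: "segment_point u v ` closed_segment s t \<subseteq> A" and s: "segment_point u v s \<in> U"
    have e': "{v, u} \<in> edges G" using e by (simp add: insert_commute)
    note uv = simple_graph_edge(3)[OF G e]
    have tA: "segment_point u v t \<in> A" using seg by auto
    have segA: "segment_point u v p \<in> A" if "s \<le> p \<and> p \<le> t \<or> t \<le> p \<and> p \<le> s" for p
      using seg that by (auto simp: closed_segment_eq_real_ivl split: if_splits)
    have from_u: "segment_point u v t \<in> U"
      if "u \<in> ?W" "\<And>p. 0 \<le> p \<Longrightarrow> p \<le> s \<Longrightarrow> segment_point u v p \<in> A"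
    proof -
      have "segment_point u v p \<in> A" if "p \<in> {0..t}" for p
        using \<open>\<And>p. 0 \<le> p \<Longrightarrow> p \<le> s \<Longrightarrow> segment_point u v p \<in> A\<close>[of p] segA[of p] that by fastforce
      then have "segment_point u v ` {0..t} \<subseteq> A" by blast
      then show ?thesis using that(1) e st tA unfolding U_def by blast
    qed
    have from_v: "segment_point u v t \<in> U"
      if "v \<in> ?W" "\<And>p. s \<le> p \<Longrightarrow> p \<le> 1 \<Longrightarrow> segment_point u v p \<in> A"
    proof -
      have "segment_point v u p \<in> A" if "p \<in> {0..1 - t}" for p
        using \<open>\<And>p. s \<le> p \<Longrightarrow> p \<le> 1 \<Longrightarrow> segment_point u v p \<in> A\<close>[of "1 - p"] segA[of "1 - p"] that
        unfolding segment_point_swap[of v u] by fastforce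
      then have "segment_point v u ` {0..1 - t} \<subseteq> A" by blast
      moreover have "segment_point u v t = segment_point v u (1 - t)"
        by (simp add: segment_point_swap[of v u])
      moreover have "1 - t \<in> {0..1}" using st by auto
      ultimately show ?thesis using that(1) e' tA unfolding U_def by blast
    qed
    consider "s = 0" | "s = 1" | "0 < s" "s < 1" using st by fastforce
    then show "segment_point u v t \<in> U"
    proof cases
      case 1
      then have "u \<in> ?W" using vertex s by simp
      moreover have "segment_point u v p \<in> A" if "0 \<le> p" "p \<le> s" for p
        using segA[of p] 1 that st by auto
      ultimately show ?thesis by (rule from_u)
    next
      case 2
      then have "v \<in> ?W" using vertex s by simp
      moreover have "segment_point u v p \<in> A" if "s \<le> p" "p \<le> 1" for p
        using segA[of p] 2 that st by auto
      ultimately show ?thesis by (rule from_v)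
    next
      case 3
      from s obtain w where w: "w \<in> ?W" and "segment_point u v s = vertex_point w \<or>
        (\<exists>z t. {w, z} \<in> edges G \<and> t \<in> {0..1} \<and>
          segment_point u v s = segment_point w z t \<and> segment_point w z ` {0..t} \<subseteq> A)"
        unfolding U_def by auto
      moreover have "segment_point u v s \<noteq> vertex_point w"
        using vertex_point_eq_segment_point[OF _ uv, of w s] 3 by auto
      ultimately obtain z p where zp: "{w, z} \<in> edges G" "segment_point u v s = segment_point w z p"
        "segment_point w z ` {0..p} \<subseteq> A" by blast
      from inner_segment_point_eq[OF zp(2) 3 uv simple_graph_edge(3)[OF G zp(1)]]
      consider "u = w" "v = z" "s = p" | "u = z" "v = w" "s = 1 - p" by blast
      then show ?thesis
      proof cases
        case 1
        show ?thesis
        proof (rule from_u)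
          show "u \<in> ?W" using 1 w by simp
          show "segment_point u v q \<in> A" if "0 \<le> q" "q \<le> s" for q
            using zp(3) 1 that by auto
        qed
      next
        case 2
        show ?thesis
        proof (rule from_v)
          show "v \<in> ?W" using 2 w by simp
          show "segment_point u v q \<in> A" if "s \<le> q" "q \<le> 1" for q
          proof -
            have "segment_point w z (1 - q) \<in> A" using zp(3) 2 that by auto
            then show ?thesis using 2 by (simp add: segment_point_swap[of w z])
          qed
        qed
      qed
    qed
  qed
  then show ?thesis using vertex[of b] b by simp
qed

text \<open>Without vertices in it, \<open>A\<close> cannot be left along the edge that contains one of its points
  except at the ends of that edge, which do not belong to \<open>A\<close>; so \<open>A\<close> lies inside one edge.\<close>

lemma connected_open_without_vertices:
  assumes G: "simple_graph G" and A: "openin (graph_topology G) A" "connectedin (graph_topology G) A"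
    and none: "\<And>w. vertex_point w \<notin> A"
  obtains W where "finite W" "A \<subseteq> {x \<in> graph_points G. point_support x \<subseteq> W}"
proof (cases "A = {}")
  case False
  then obtain x where x: "x \<in> A" by blast
  have AG: "A \<subseteq> graph_points G" using A(1) by (auto simp: openin_graph_topology)
  let ?W = "point_support x"
  have "A \<inter> {y. point_support y \<subseteq> ?W} = A"
  proof (rule connected_open_eq_if_closed_along_edges[OF A])
    show "A \<inter> {y. point_support y \<subseteq> ?W} \<noteq> {}" using x by auto
    fix u v and s t :: real
    assume e: "{u, v} \<in> edges G" and st: "s \<in> {0..1}" "t \<in> {0..1}"
      and seg: "segment_point u v ` closed_segment s t \<subseteq> A"
      and s: "segment_point u v s \<in> A \<inter> {y. point_support y \<subseteq> ?W}"
    have "s \<noteq> 0" "s \<noteq> 1" using s none by (auto intro!: notI)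
    then have "u \<in> point_support (segment_point u v s)" "v \<in> point_support (segment_point u v s)"
      using simple_graph_edge(3)[OF G e] by (auto simp: point_support_def segment_point_apply)
    then have "{u, v} \<subseteq> ?W" using s by blast
    then have "point_support (segment_point u v t) \<subseteq> ?W"
      using point_support_segment_point[of u v t] by blast
    then show "segment_point u v t \<in> A \<inter> {y. point_support y \<subseteq> ?W}" using seg by auto
  qed auto
  then have "A \<subseteq> {y \<in> graph_points G. point_support y \<subseteq> ?W}" using AG by blast
  moreover have "finite ?W"
    using finite_support_vertices_of_compactin[OF G, of "{x}"] x AG
    by (auto simp: topspace_graph_topology)
  ultimately show thesis using that by blast
qed (use that[of "{}"] in auto)


section \<open>Rays from nested relations\<close>

text \<open>Concatenating the paths gives a walk on which each vertex recurs only finitely often, since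
  the walk eventually stays in every \<open>D n\<close>. Cutting it short at last visits makes it injective
  while all steps remain steps of the walk.\<close>

lemma ray_through_nested_relations:
  fixes R :: "nat \<Rightarrow> 'v \<Rightarrow> 'v \<Rightarrow> bool" and D :: "nat \<Rightarrow> 'v set"
  assumes R_antimono: "\<And>n x y. R (Suc n) x y \<Longrightarrow> R n x y"
    and D_antimono: "\<And>n. D (Suc n) \<subseteq> D n"
    and R_D: "\<And>n x y. R n x y \<Longrightarrow> y \<in> D n"
    and leaves: "\<And>x. \<exists>n. x \<notin> D n"
    and v: "\<And>n. v n \<in> D n"
    and path: "\<And>n. (R n)\<^sup>*\<^sup>* (v n) (v (Suc n))"
  obtains r where "inj r" "\<And>n. \<exists>N. \<forall>i\<ge>N. R n (r i) (r (Suc i))"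
proof -
  have "\<exists>f k. f 0 = v n \<and> f k = v (Suc n) \<and> (\<forall>i<k. R n (f i) (f (Suc i)))" for n
    using path[of n] by (metis relpowp_fun_conv rtranclp_imp_relpowp)
  then obtain f k where f0: "\<And>n. f n 0 = v n" and fk: "\<And>n. f n (k n) = v (Suc n)"
    and fR: "\<And>n i. i < k n \<Longrightarrow> R n (f n i) (f n (Suc i))"
    by metis
  \<comment> \<open>The walk runs through the chosen paths one after the other; a state \<open>(n, i)\<close> is position
    \<open>i\<close> on the \<open>n\<close>-th path. Changing to the next path repeats a vertex.\<close>
  define step where "step = (\<lambda>(n, i). if i < k n then (n, Suc i) else (Suc n, 0::nat))"
  define st where "st m = (step ^^ m) (0, 0)" for m
  define l where "l m = fst (st m)" for m
  define w where "w m = f (l m) (snd (st m))" for m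
  have st_Suc: "st (Suc m) = step (st m)" for m by (simp add: st_def)
  have st_le: "snd (st m) \<le> k (fst (st m))" for m
  proof (induction m)
    case (Suc m)
    then show ?case unfolding st_Suc step_def by (cases "st m") auto
  qed (simp add: st_def)
  have walk: "w (Suc m) = w m \<or> R (l m) (w m) (w (Suc m))" for m
  proof (cases "st m")
    case (Pair n i)
    show ?thesis
    proof (cases "i < k n")
      case True
      then show ?thesis using Pair fR[OF True] by (simp add: w_def l_def st_Suc step_def)
    next
      case False
      then have "i = k n" using st_le[of m] Pair by simp
      then show ?thesis using Pair f0 fk by (simp add: w_def l_def st_Suc step_def)
    qed
  qed
  have R_mono: "R m x y" if "m \<le> n" "R n x y" for m n x y
    using that by (induction n rule: dec_induct) (auto intro: R_antimono)
  have D_mono: "D n \<subseteq> D m" if "m \<le> n" for m n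
    using that by (rule lift_Suc_antimono_le[of D, OF D_antimono])
  have wD: "w m \<in> D (l m)" for m
  proof (cases "snd (st m)")
    case 0
    then show ?thesis using v f0 by (simp add: w_def)
  next
    case (Suc i)
    then have "i < k (l m)" using st_le[of m] by (simp add: l_def)
    from R_D[OF fR[OF this]] show ?thesis using Suc by (simp add: w_def)
  qed
  have l_mono: "l m \<le> l m'" if "m \<le> m'" for m m'
  proof (rule lift_Suc_mono_le[OF _ that])
    show "l n \<le> l (Suc n)" for n by (cases "st n") (simp add: l_def st_Suc step_def)
  qed
  have reached: "\<exists>m. st m = (n, 0)" for n
  proof (induction n)
    case 0
    have "st 0 = (0, 0)" by (simp add: st_def)
    then show ?case by blast
  next
    case (Suc n)
    have "\<exists>m. st m = (n, i)" if "i \<le> k n" for i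
      using that
    proof (induction i)
      case (Suc i)
      then obtain m where "st m = (n, i)" by auto
      then have "st (Suc m) = (n, Suc i)" using Suc.prems by (simp add: st_Suc step_def)
      then show ?case by blast
    qed (use Suc in simp)
    then obtain m where "st m = (n, k n)" by auto
    then have "st (Suc m) = (Suc n, 0)" by (simp add: st_Suc step_def)
    then show ?case by blast
  qed
  have late: "\<exists>N. \<forall>m\<ge>N. n \<le> l m" for n
  proof -
    obtain N where "st N = (n, 0)" using reached by blast
    then have "\<forall>m\<ge>N. n \<le> l m" using l_mono[of N] by (auto simp: l_def)
    then show ?thesis by blast
  qed
  have fin: "finite {m. w m = x}" for x
  proof -
    obtain n where n: "x \<notin> D n" using leaves by blast
    obtain N where N: "\<forall>m\<ge>N. n \<le> l m" using late by blast
    have "m < N" if "w m = x" for m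
    proof (rule ccontr)
      assume "\<not> m < N"
      then have "n \<le> l m" using N by simp
      then have "x \<in> D n" using wD[of m] D_mono[of n "l m"] that by auto
      with n show False by simp
    qed
    then have "{m. w m = x} \<subseteq> {..<N}" by auto
    then show ?thesis by (rule finite_subset) simp
  qed
  \<comment> \<open>The ray leaves each of its vertices at the last visit of the walk.\<close>
  define last_visit where "last_visit x = Max {m. w m = x}" for x
  have last_ge: "m \<le> last_visit (w m)" for m
    unfolding last_visit_def by (rule Max_ge[OF fin]) simp
  have w_last: "w (last_visit (w m)) = w m" for m
    using Max_in[OF fin[of "w m"]] unfolding last_visit_def by auto
  define j where "j = rec_nat (last_visit (w 0)) (\<lambda>_ i. last_visit (w (Suc i)))"
  define r where "r i = w (j i)" for i
  have j_Suc: "j (Suc i) = last_visit (w (Suc (j i)))" for i by (simp add: j_def)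
  have last_r: "last_visit (r i) = j i" for i
  proof -
    obtain m where "j i = last_visit (w m)" by (cases i) (auto simp: j_def)
    then show ?thesis unfolding r_def by (simp add: w_last)
  qed
  have j_less: "j i < j (Suc i)" for i
    using last_ge[of "Suc (j i)"] by (simp add: j_Suc)
  then have j_ge: "i \<le> j i" for i
    using strict_mono_imp_increasing[of j] by (simp add: strict_mono_Suc_iff)
  have r_Suc: "r (Suc i) = w (Suc (j i))" for i by (simp add: r_def j_Suc w_last)
  have r_step: "R (l (j i)) (r i) (r (Suc i))" for i
  proof -
    have "w (Suc (j i)) \<noteq> w (j i)"
    proof
      assume "w (Suc (j i)) = w (j i)"
      then have "Suc (j i) \<le> last_visit (r i)" using last_ge[of "Suc (j i)"] by (simp add: r_def)
      then show False by (simp add: last_r)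
    qed
    then show ?thesis using walk[of "j i"] unfolding r_Suc by (simp add: r_def)
  qed
  show thesis
  proof (rule that)
    show "inj r"
    proof (rule injI)
      fix i i' assume "r i = r i'"
      then have "j i = j i'" using last_r by metis
      moreover have "strict_mono j" using j_less by (simp add: strict_mono_Suc_iff)
      ultimately show "i = i'" by (simp add: strict_mono_eq)
    qed
    show "\<exists>N. \<forall>i\<ge>N. R n (r i) (r (Suc i))" for n
    proof -
      obtain N where N: "\<forall>m\<ge>N. n \<le> l m" using late by blast
      have "R n (r i) (r (Suc i))" if "N \<le> i" for i
      proof -
        have "n \<le> l (j i)" using N that j_ge[of i] by simp
        then show ?thesis using r_step R_mono by blast
      qed
      then show ?thesis by blast
    qed
  qed
qed


section \<open>The end of a chain\<close>

lemma end_chainD: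
  assumes "end_chain X A"
  shows "openin X (A n)" "A n \<noteq> {}" "connectedin X (A n)" "A (Suc n) \<subseteq> A n"
    "compactin X (X frontier_of A n)" "(\<Inter>n. X closure_of A n) = {}"
  using assms unfolding end_chain_def by auto

lemma end_chain_antimono:
  assumes "end_chain X A" "m \<le> n"
  shows "A n \<subseteq> A m"
  using assms(2) by (rule lift_Suc_antimono_le[of A, OF end_chainD(4)[OF assms(1)]])

lemma end_chain_subset_closure: "end_chain X A \<Longrightarrow> A n \<subseteq> X closure_of A n"
  by (intro closure_of_subset openin_subset end_chainD(1))

lemma end_chain_leaves_finite:
  assumes A: "end_chain X A" and F: "finite F"
  obtains n where "F \<inter> X closure_of A n = {}"
proof -
  have "\<exists>n. F \<inter> X closure_of A n = {}"
    using F
  proof induction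
    case (insert x F)
    then obtain n where n: "F \<inter> X closure_of A n = {}" by blast
    obtain m where m: "x \<notin> X closure_of A m" using end_chainD(6)[OF A] by blast
    have "X closure_of A (max n m) \<subseteq> X closure_of A n" "X closure_of A (max n m) \<subseteq> X closure_of A m"
      by (intro closure_of_mono end_chain_antimono[OF A]; simp)+
    then have "insert x F \<inter> X closure_of A (max n m) = {}" using n m by blast
    then show ?case by blast
  qed simp
  with that show ?thesis by blast
qed

text \<open>Inside a compact set, decreasing non-empty closed sets would have a common point.\<close>

lemma end_chain_not_subset_compact:
  assumes A: "end_chain X A" and K: "compactin X K"
  shows "\<not> A n \<subseteq> K"
proof
  assume AK: "A n \<subseteq> K"
  let ?U = "\<lambda>m. topspace X - X closure_of A m"
  have "K \<subseteq> topspace X" by (rule compactin_subset_topspace[OF K])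
  then have "K \<subseteq> \<Union>(range ?U)" using end_chainD(6)[OF A] by auto
  moreover have "\<And>U. U \<in> range ?U \<Longrightarrow> openin X U" by auto
  ultimately obtain F where F: "finite F" "F \<subseteq> range ?U" "K \<subseteq> \<Union>F"
    using compactinD[OF K, of "range ?U"] by blast
  from finite_subset_image[OF F(1,2)] obtain I where I: "finite I" "F = ?U ` I" by blast
  obtain m where m: "n \<le> m" "\<And>i. i \<in> I \<Longrightarrow> i \<le> m"
    using finite_nat_set_iff_bounded_le[of "insert n I"] I(1) by auto
  obtain x where x: "x \<in> A m" using end_chainD(2)[OF A] by blast
  have "x \<in> K" using x AK end_chain_antimono[OF A m(1)] by blast
  then obtain i where i: "i \<in> I" "x \<notin> X closure_of A i" using F(3) I(2) by blast
  moreover have "A m \<subseteq> A i" by (rule end_chain_antimono[OF A m(2)[OF i(1)]])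
  ultimately show False using x end_chain_subset_closure[OF A, of i] by blast
qed

lemma end_chain_has_vertex:
  assumes G: "simple_graph G" and A: "end_chain (graph_topology G) A"
  shows "\<exists>w. vertex_point w \<in> A n"
proof (rule ccontr)
  assume "\<not> ?thesis"
  then obtain W where "finite W" "A n \<subseteq> {x \<in> graph_points G. point_support x \<subseteq> W}"
    using connected_open_without_vertices[OF G end_chainD(1,3)[OF A]] by blast
  with end_chain_not_subset_compact[OF A compactin_supported[OF G]] show False by blast
qed

definition runs_into :: "'v ugraph \<Rightarrow> (nat \<Rightarrow> 'v) \<Rightarrow> (nat \<Rightarrow> ('v \<Rightarrow> real) set) \<Rightarrow> bool" where
  "runs_into G r A \<longleftrightarrow> (\<forall>n. \<exists>N. \<forall>i\<ge>N. edge_inside G (A n) (r i) (r (Suc i)))"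

lemma end_chain_obtain_ray:
  assumes G: "simple_graph G" and A: "end_chain (graph_topology G) A"
  obtains r where "r \<in> rays G" "runs_into G r A"
proof -
  obtain v where v: "\<And>n. vertex_point (v n) \<in> A n"
    using end_chain_has_vertex[OF G A] by metis
  obtain s where s: "inj s" "\<And>n. \<exists>N. \<forall>i\<ge>N. edge_inside G (A n) (s i) (s (Suc i))"
  proof (rule ray_through_nested_relations[of "\<lambda>n. edge_inside G (A n)" "\<lambda>n. {w. vertex_point w \<in> A n}" v])
    show "edge_inside G (A n) x y" if "edge_inside G (A (Suc n)) x y" for n x y
      using that end_chainD(4)[OF A, of n] by (auto simp: edge_inside_def)
    show "{w. vertex_point w \<in> A (Suc n)} \<subseteq> {w. vertex_point w \<in> A n}" for n
      using end_chainD(4)[OF A, of n] by auto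
    show "\<exists>n. x \<notin> {w. vertex_point w \<in> A n}" for x
    proof -
      obtain n where "{vertex_point x} \<inter> graph_topology G closure_of A n = {}"
        using end_chain_leaves_finite[OF A, of "{vertex_point x}"] by auto
      then show ?thesis using end_chain_subset_closure[OF A, of n] by auto
    qed
    show "(edge_inside G (A n))\<^sup>*\<^sup>* (v n) (v (Suc n))" for n
      using v[of n] v[of "Suc n"] end_chainD(4)[OF A, of n]
      by (intro reach_inside_connected_open[OF G end_chainD(1,3)[OF A]]) auto
  qed (use v in \<open>auto dest: edge_insideD\<close>)
  obtain N0 where N0: "\<forall>i\<ge>N0. edge_inside G (A 0) (s i) (s (Suc i))" using s(2) by blast
  show thesis
  proof (rule that)
    \<comment> \<open>An initial part of \<open>s\<close> is cut off, as only tails of \<open>s\<close> are known to run along edges.\<close>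
    let ?r = "\<lambda>i. s (i + N0)"
    have e: "{?r i, ?r (Suc i)} \<in> edges G" for i
      using edge_insideD(1)[of G "A 0" "?r i" "?r (Suc i)"] N0 by simp
    show "?r \<in> rays G"
      unfolding rays_def
    proof (intro CollectI conjI allI)
      show "inj ?r" by (rule injI) (use injD[OF s(1)] in fastforce)
      show "range ?r \<subseteq> verts G" using simple_graph_edge(1)[OF G e] by blast
      show "{?r i, ?r (Suc i)} \<in> edges G" for i by (rule e)
    qed
    show "runs_into G ?r A"
      unfolding runs_into_def
    proof
      fix n
      obtain N where "\<forall>i\<ge>N. edge_inside G (A n) (s i) (s (Suc i))" using s(2) by blast
      then have "\<forall>i\<ge>N. edge_inside G (A n) (?r i) (?r (Suc i))" by simp
      then show "\<exists>N. \<forall>i\<ge>N. edge_inside G (A n) (?r i) (?r (Suc i))" by blast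
    qed
  qed
qed

lemma graph_points_tail_graph_subset:
  assumes "\<And>i. N \<le> i \<Longrightarrow> edge_inside G A (r i) (r (Suc i))"
  shows "graph_points (tail_graph r N) \<subseteq> A"
proof
  fix x assume "x \<in> graph_points (tail_graph r N)"
  then consider "x \<in> vertex_point ` verts (tail_graph r N)"
    | u v t where "{u, v} \<in> edges (tail_graph r N)" "t \<in> {0..1}" "x = segment_point u v t"
    unfolding graph_points_def by blast
  then show "x \<in> A"
  proof cases
    case 1
    then show ?thesis using edge_insideD(2)[OF assms] by (auto simp: tail_graph_def)
  next
    case (2 u v t)
    then obtain i where i: "N \<le> i" "{u, v} = {r i, r (Suc i)}" by (auto simp: tail_graph_def)
    have in_A: "segment_point (r i) (r (Suc i)) ` {0..1} \<subseteq> A"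
      using assms[OF i(1)] by (simp add: edge_inside_def)
    from i(2) consider "u = r i" "v = r (Suc i)" | "v = r i" "u = r (Suc i)"
      by (auto simp: doubleton_eq_iff)
    then show ?thesis
    proof cases
      case 1
      then show ?thesis using 2 in_A by blast
    next
      case b: 2
      have "1 - t \<in> {0..1}" using 2 by simp
      then have "segment_point (r i) (r (Suc i)) (1 - t) \<in> A" using in_A by blast
      then show ?thesis using 2 b segment_point_swap[of u v t] by simp
    qed
  qed
qed

text \<open>An edge is connected, so it cannot leave \<open>A\<close> without meeting the frontier.\<close>

lemma edge_inside_avoiding_frontier:
  assumes e: "{x, y} \<in> edges G" and x: "vertex_point x \<in> A"
    and av: "\<And>z. z \<in> segment_point x y ` {0..1} \<Longrightarrow> z \<notin> graph_topology G frontier_of A"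
  shows "edge_inside G A x y"
proof -
  let ?S = "segment_point x y ` {0..1}"
  have "segment_point x y 0 \<in> ?S" by (intro imageI) simp
  then have "?S \<inter> A \<noteq> {}" using x by auto
  moreover have "connectedin (graph_topology G) ?S"
    using e by (intro connectedin_edge_part) auto
  moreover have "?S \<inter> graph_topology G frontier_of A = {}" using av by blast
  ultimately have "?S \<subseteq> A" using connectedin_Int_frontier_of[of _ ?S A] by blast
  with e show ?thesis by (simp add: edge_inside_def)
qed

lemma edge_inside_off_frontier_support:
  assumes G: "simple_graph G" and e: "{x, y} \<in> edges G" and x: "vertex_point x \<in> A"
    and off: "{x, y} \<inter> \<Union>(point_support ` (graph_topology G frontier_of A)) = {}"
  shows "edge_inside G A x y"
  using e x
proof (rule edge_inside_avoiding_frontier)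
  fix z assume z: "z \<in> segment_point x y ` {0..1}"
  then have "z \<in> graph_points G" using segment_point_in_graph_points[OF e] by auto
  then obtain w where w: "w \<in> point_support z" using point_support_nonempty[OF G] by auto
  obtain t where "z = segment_point x y t" using z by auto
  then have "w \<in> {x, y}" using w point_support_segment_point[of x y t] by auto
  with w off show "z \<notin> graph_topology G frontier_of A" by blast
qed

text \<open>The vertices that carry frontier points of \<open>A\<close> separate the vertices in \<open>A\<close> from those
  outside, since no edge between other vertices meets the frontier.\<close>

lemma reach_avoiding_frontier_support:
  assumes G: "simple_graph G"
    and reach: "reach (del_verts G (\<Union>(point_support ` (graph_topology G frontier_of A)))) a b"
    and a: "vertex_point a \<in> A"
  shows "vertex_point b \<in> A"
  using reach a
proof (induction rule: rtranclp_induct)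
  case (step y z)
  then have e: "{y, z} \<in> edges G"
    and "{y, z} \<inter> \<Union>(point_support ` (graph_topology G frontier_of A)) = {}"
    by (auto simp: del_verts_def)
  then have "edge_inside G A y z"
    using step.IH[OF step.prems] by (intro edge_inside_off_frontier_support[OF G])
  then show ?case by (rule edge_insideD)
qed

text \<open>Tails of equivalent rays are joined outside the finite set of vertices that carries the
  frontier of \<open>A n\<close>, and both tails lie on the same side of it.\<close>

lemma runs_into_end_rel:
  assumes G: "simple_graph G" and A: "end_chain (graph_topology G) A"
    and r: "runs_into G r A" and rs: "(r, s) \<in> end_rel G"
  shows "runs_into G s A"
  unfolding runs_into_def
proof
  fix n
  let ?F = "graph_topology G frontier_of A n"
  let ?X = "\<Union>(point_support ` ?F)"
  have fin: "finite ?X" by (rule finite_support_vertices_of_compactin[OF G end_chainD(5)[OF A]])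
  have "?F \<subseteq> graph_points G"
    using frontier_of_subset_topspace[of "graph_topology G"] by (simp add: topspace_graph_topology)
  then have sub: "?X \<subseteq> verts G" using point_support_subset_verts[OF G] by blast
  have ray: "r \<in> rays G" "s \<in> rays G" using rs by (auto simp: end_rel_def)
  obtain N where N: "tail_in (del_verts G ?X) r N" using obtain_tail_in_del_verts[OF ray(1) fin] .
  obtain M where M: "tail_in (del_verts G ?X) s M" using obtain_tail_in_del_verts[OF ray(2) fin] .
  obtain K where K: "\<forall>i\<ge>K. edge_inside G (A n) (r i) (r (Suc i))" using r unfolding runs_into_def by blast
  have "edge_inside G (A n) (r (max N K)) (r (Suc (max N K)))" using K by simp
  then have "vertex_point (r (max N K)) \<in> A n" by (rule edge_insideD)
  moreover have "reach (del_verts G ?X) (r (max N K)) (s M)"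
  proof (rule rtranclp_trans)
    show "reach (del_verts G ?X) (r (max N K)) (r N)" by (rule reach_tail[OF N]) auto
    show "reach (del_verts G ?X) (r N) (s M)" by (rule end_relD[OF G rs fin sub N M])
  qed
  ultimately have sM: "vertex_point (s M) \<in> A n"
    by (rule reach_avoiding_frontier_support[OF G, rotated])
  have "edge_inside G (A n) (s i) (s (Suc i))" if i: "M \<le> i" for i
  proof -
    have "reach (del_verts G ?X) (s M) (s i)" by (rule reach_tail[OF M]) (use i in auto)
    then have "vertex_point (s i) \<in> A n" using sM by (rule reach_avoiding_frontier_support[OF G])
    moreover have e: "{s i, s (Suc i)} \<in> edges G" and "{s i, s (Suc i)} \<inter> ?X = {}"
      using M i by (auto simp: tail_in_def del_verts_def)
    ultimately show ?thesis by (intro edge_inside_off_frontier_support[OF G])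
  qed
  then show "\<exists>N. \<forall>i\<ge>N. edge_inside G (A n) (s i) (s (Suc i))" by blast
qed

text \<open>A finite set of vertices is disjoint from \<open>A n\<close> for large \<open>n\<close>, and inside \<open>A n\<close> the two
  tails are joined by a path.\<close>

lemma end_rel_if_tails_in_chain:
  assumes G: "simple_graph G" and A: "end_chain (graph_topology G) A"
    and ray: "r \<in> rays G" "s \<in> rays G"
    and r: "\<And>n. \<exists>T. is_tail T r \<and> graph_points T \<subseteq> A n"
    and s: "\<And>n. \<exists>T. is_tail T s \<and> graph_points T \<subseteq> A n"
  shows "(r, s) \<in> end_rel G"
proof (rule end_relI[OF G ray])
  fix X N M
  assume X: "finite X" "X \<subseteq> verts G"
    and N: "tail_in (del_verts G X) r N" and M: "tail_in (del_verts G X) s M"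
  obtain n where n: "vertex_point ` X \<inter> graph_topology G closure_of A n = {}"
    using end_chain_leaves_finite[OF A finite_imageI[OF X(1)]] .
  obtain T where T: "is_tail T r" "graph_points T \<subseteq> A n" using r by blast
  obtain S where S: "is_tail S s" "graph_points S \<subseteq> A n" using s by blast
  obtain i where i: "N \<le> i" "r i \<in> verts T" using is_tail_obtain_late[OF T(1)] .
  obtain j where j: "M \<le> j" "s j \<in> verts S" using is_tail_obtain_late[OF S(1)] .
  have "vertex_point (r i) \<in> A n" "vertex_point (s j) \<in> A n"
    using vertex_point_in_graph_points[OF i(2)] vertex_point_in_graph_points[OF j(2)] T(2) S(2) by blast+
  then have "(edge_inside G (A n))\<^sup>*\<^sup>* (r i) (s j)"
    by (rule reach_inside_connected_open[OF G end_chainD(1,3)[OF A]])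
  moreover have "(edge_inside G (A n))\<^sup>*\<^sup>* \<le> reach (del_verts G X)"
  proof (rule rtranclp_mono, rule predicate2I)
    show "{x, y} \<in> edges (del_verts G X)" if "edge_inside G (A n) x y" for x y
      using edge_insideD[OF that] n end_chain_subset_closure[OF A, of n] by (auto simp: del_verts_def)
  qed
  ultimately have "reach (del_verts G X) (r i) (s j)" by (rule predicate2D[rotated])
  moreover have "reach (del_verts G X) (r N) (r i)" by (rule reach_tail[OF N]) (use i in auto)
  moreover have "reach (del_verts G X) (s j) (s M)" by (rule reach_tail[OF M]) (use j in auto)
  ultimately show "reach (del_verts G X) (r N) (s M)" by (meson rtranclp_trans)
qed

lemma path_rtranclp:
  assumes "is_path G p"
  shows "(\<lambda>x y. {x, y} \<in> edges G \<and> x \<in> set p \<and> y \<in> set p)\<^sup>*\<^sup>* (hd p) (last p)"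
proof -
  let ?R = "\<lambda>x y. {x, y} \<in> edges G \<and> x \<in> set p \<and> y \<in> set p"
  have "?R\<^sup>*\<^sup>* (p ! 0) (p ! i)" if "i < length p" for i
    using that
  proof (induction i)
    case (Suc i)
    then have "{p ! i, p ! Suc i} \<in> edges G" using assms by (simp add: is_path_def)
    then have step: "?R (p ! i) (p ! Suc i)" using Suc.prems by simp
    have "?R\<^sup>*\<^sup>* (p ! 0) (p ! i)" using Suc by simp
    then show ?case using step by (rule rtranclp.rtrancl_into_rtrancl)
  qed simp
  from this[of "length p - 1"] show ?thesis
    using assms by (simp add: is_path_def hd_conv_nth last_conv_nth)
qed

text \<open>Of the infinitely many paths of a fan from \<open>v\<close> only finitely many meet a given finite set
  outside \<open>v\<close>, so one of them crosses the frontier of \<open>A n\<close> nowhere except possibly in \<open>v\<close>,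
  which has left the closure of \<open>A n\<close>.\<close>

lemma non_dominated_if_runs_into:
  assumes G: "simple_graph G" and A: "end_chain (graph_topology G) A" and r: "runs_into G r A"
  shows "non_dominated G r"
  unfolding non_dominated_def
proof clarify
  fix v assume "v \<in> verts G" "dominates G v r"
  then obtain P where "infinite P" and P_path: "\<forall>p\<in>P. is_path G p \<and> hd p = v \<and> last p \<in> range r"
    and P_fan: "\<forall>p\<in>P. \<forall>q\<in>P. p \<noteq> q \<longrightarrow> set p \<inter> set q = {v}"
    unfolding dominates_def by (elim exE conjE) (rule that)
  obtain n where "{vertex_point v} \<inter> graph_topology G closure_of A n = {}"
    using end_chain_leaves_finite[OF A, of "{vertex_point v}"] by auto
  then have v: "vertex_point v \<notin> graph_topology G closure_of A n" by simp
  let ?F = "graph_topology G frontier_of A n"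
  let ?X = "\<Union>(point_support ` ?F)"
  obtain N where N: "\<forall>i\<ge>N. edge_inside G (A n) (r i) (r (Suc i))" using r unfolding runs_into_def by blast
  \<comment> \<open>A path off \<open>Z\<close> other than \<open>[v]\<close> ends in the tail of \<open>r\<close> that lies in \<open>A n\<close>.\<close>
  define Z where "Z = (?X \<union> r ` {..<N}) - {v}"
  have "finite Z"
    unfolding Z_def using finite_support_vertices_of_compactin[OF G end_chainD(5)[OF A]] by simp
  have "finite {p \<in> P. z \<in> set p}" if "z \<in> Z" for z
  proof -
    have unique: "p = q" if "p \<in> P" "q \<in> P" "z \<in> set p" "z \<in> set q" for p q
    proof (rule ccontr)
      assume "p \<noteq> q"
      then have "set p \<inter> set q = {v}" using P_fan that(1,2) by simp
      then show False using that(3,4) \<open>z \<in> Z\<close> by (auto simp: Z_def)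
    qed
    show ?thesis
    proof (cases "{p \<in> P. z \<in> set p} = {}")
      case False
      then obtain q where "q \<in> P" "z \<in> set q" by blast
      then have "{p \<in> P. z \<in> set p} \<subseteq> {q}" using unique by blast
      then show ?thesis by (rule finite_subset) simp
    qed (simp only: finite.emptyI)
  qed
  then have "finite (\<Union>z\<in>Z. {p \<in> P. z \<in> set p})" using \<open>finite Z\<close> by blast
  then have "infinite (P - insert [v] (\<Union>z\<in>Z. {p \<in> P. z \<in> set p}))" using \<open>infinite P\<close> by simp
  then have "P - insert [v] (\<Union>z\<in>Z. {p \<in> P. z \<in> set p}) \<noteq> {}" by (rule infinite_imp_nonempty)
  then obtain p where "p \<in> P - insert [v] (\<Union>z\<in>Z. {p \<in> P. z \<in> set p})" by blast
  then have p: "p \<in> P" "p \<noteq> [v]" and pZ: "set p \<inter> Z = {}" by auto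
  have path: "is_path G p" "hd p = v" "last p \<in> range r" using P_path p(1) by auto
  have "last p \<noteq> v"
  proof
    assume l: "last p = v"
    obtain q where "p = v # q" using path(1,2) by (cases p) (auto simp: is_path_def)
    with l p(2) path(1) show False by (auto simp: is_path_def split: if_splits)
  qed
  moreover have "last p \<in> set p" using path(1) by (simp add: is_path_def)
  ultimately have "last p \<notin> r ` {..<N}" using pZ by (auto simp: Z_def)
  moreover obtain i where i: "last p = r i" using path(3) by auto
  ultimately have "N \<le> i" by (metis image_eqI lessThan_iff not_le)
  have "(\<lambda>x y. {x, y} \<in> edges G \<and> x \<in> set p \<and> y \<in> set p)\<^sup>*\<^sup>* (last p) v"
    using path_rtranclp[OF path(1)] path(2)
      sympD[OF symp_rtranclp, of "\<lambda>x y. {x, y} \<in> edges G \<and> x \<in> set p \<and> y \<in> set p"]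
    by (auto simp: symp_def insert_commute)
  then have "vertex_point v \<in> A n"
  proof (induction rule: rtranclp_induct)
    case base
    have "edge_inside G (A n) (r i) (r (Suc i))" using N \<open>N \<le> i\<close> by simp
    then show ?case unfolding i by (rule edge_insideD)
  next
    case (step y z)
    have "edge_inside G (A n) y z"
    proof (rule edge_inside_avoiding_frontier)
      show e: "{y, z} \<in> edges G" using step by blast
      show "vertex_point y \<in> A n" using step by blast
      fix x assume x: "x \<in> segment_point y z ` {0..1}"
      show "x \<notin> ?F"
      proof
        assume xF: "x \<in> ?F"
        have xG: "x \<in> graph_points G" using x segment_point_in_graph_points[OF e] by blast
        obtain t where "x = segment_point y z t" using x by auto
        then have "point_support x \<subseteq> {y, z}" using point_support_segment_point[of y z t] by simp
        moreover have "point_support x \<subseteq> ?X" using xF by blast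
        ultimately have supp: "point_support x \<subseteq> {v}" using pZ step(2) unfolding Z_def by blast
        from G xG have "x = vertex_point v"
        proof (cases rule: graph_points_cases)
          case (2 a b t)
          then have "a \<in> point_support x" "b \<in> point_support x"
            using simple_graph_edge(3)[OF G 2(1)] by (simp_all add: point_support_def segment_point_apply)
          then show ?thesis using supp simple_graph_edge(3)[OF G 2(1)] by blast
        qed (use supp in simp)
        then show False using xF v by (simp add: frontier_of_def)
      qed
    qed
    then show ?case by (rule edge_insideD)
  qed
  then show False using v end_chain_subset_closure[OF A] by blast
qed

text \<open>Membership in the end is decided by the single chain \<open>A\<close>: equivalent chains refine each
  other, and by compactness of the frontiers an equivalent ray is not left behind.\<close>

lemma top_end_to_end_class:
  assumes G: "simple_graph G" and A: "end_chain (graph_topology G) A"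
    and ray: "r \<in> rays G" and r: "runs_into G r A"
  shows "top_end_to_end G (end_chain_rel (graph_topology G) `` {A}) = end_rel G `` {r}"
  unfolding top_end_to_end_def
proof (rule the_equality)
  have refl: "(s, s) \<in> end_rel G" if "s \<in> rays G" for s
    using that equiv_end_rel[OF G] by (meson equivE refl_onD)
  have tail: "\<exists>T. is_tail T s \<and> graph_points T \<subseteq> A n" if s: "(r, s) \<in> end_rel G" for s n
  proof -
    have "inj s" using s raysD(1) by (auto simp: end_rel_def)
    obtain N where "\<forall>i\<ge>N. edge_inside G (A n) (s i) (s (Suc i))"
      using runs_into_end_rel[OF G A r s] unfolding runs_into_def by blast
    then have "graph_points (tail_graph s N) \<subseteq> A n" by (intro graph_points_tail_graph_subset) blast
    with is_tail_tail_graph[OF \<open>inj s\<close>] show ?thesis by blast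
  qed
  show "end_rel G `` {r} \<in> ends G \<and> (\<forall>s\<in>end_rel G `` {r}.
    \<forall>B\<in>end_chain_rel (graph_topology G) `` {A}. \<forall>n. \<exists>T. is_tail T s \<and> graph_points T \<subseteq> B n)"
  proof (intro conjI ballI allI)
    show "end_rel G `` {r} \<in> ends G" unfolding ends_def by (rule quotientI[OF ray])
    fix s B n
    assume s: "s \<in> end_rel G `` {r}" and B: "B \<in> end_chain_rel (graph_topology G) `` {A}"
    from B obtain k where "A k \<subseteq> B n" unfolding end_chain_rel_def by blast
    moreover obtain T where "is_tail T s" "graph_points T \<subseteq> A k" using s tail by blast
    ultimately show "\<exists>T. is_tail T s \<and> graph_points T \<subseteq> B n" by blast
  qed
  fix \<omega>
  assume \<omega>: "\<omega> \<in> ends G \<and> (\<forall>s\<in>\<omega>.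
    \<forall>B\<in>end_chain_rel (graph_topology G) `` {A}. \<forall>n. \<exists>T. is_tail T s \<and> graph_points T \<subseteq> B n)"
  then obtain s where s: "s \<in> rays G" "\<omega> = end_rel G `` {s}" unfolding ends_def by (auto elim: quotientE)
  have "s \<in> \<omega>" using refl[OF s(1)] s(2) by simp
  moreover have "A \<in> end_chain_rel (graph_topology G) `` {A}" using A by (auto simp: end_chain_rel_def)
  ultimately have "\<exists>T. is_tail T s \<and> graph_points T \<subseteq> A n" for n using \<omega> by blast
  then have "(s, r) \<in> end_rel G"
    by (rule end_rel_if_tails_in_chain[OF G A s(1) ray _ tail[OF refl[OF ray]]])
  then show "\<omega> = end_rel G `` {r}" unfolding s(2) by (rule equiv_class_eq[OF equiv_end_rel[OF G]])
qed


section \<open>Separating finite sets from a non-dominated ray\<close>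

text \<open>Any two tails of \<open>r\<close> in \<open>G - X\<close> lie in the same component, so the choice of \<open>N\<close> is
  immaterial.\<close>

definition tail_component :: "'v ugraph \<Rightarrow> (nat \<Rightarrow> 'v) \<Rightarrow> 'v set \<Rightarrow> 'v set" where
  "tail_component G r X =
     {w. \<exists>N. tail_in (del_verts G X) r N \<and> reach (del_verts G X) (r N) w}"

lemma tail_component_subset:
  assumes "simple_graph G"
  shows "tail_component G r X \<subseteq> verts G - X"
proof
  fix w assume "w \<in> tail_component G r X"
  then obtain N where N: "tail_in (del_verts G X) r N" "reach (del_verts G X) (r N) w"
    unfolding tail_component_def by blast
  then have "w \<in> verts (del_verts G X)"
    using reach_verts[OF simple_graph_del_verts[OF assms] N(2)] by (simp add: tail_in_def)
  then show "w \<in> verts G - X" by (simp add: del_verts_def)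
qed

lemma tail_component_step:
  assumes G: "simple_graph G" and y: "y \<in> tail_component G r X"
    and e: "{y, z} \<in> edges G" and z: "z \<notin> X"
  shows "z \<in> tail_component G r X"
proof -
  have "{y, z} \<in> edges (del_verts G X)"
    using tail_component_subset[OF G, of r X] y e z by (auto simp: del_verts_def)
  with y show ?thesis
    unfolding tail_component_def by (blast intro: rtranclp.rtrancl_into_rtrancl)
qed

lemma tail_in_tail_component:
  assumes "tail_in (del_verts G X) r N" "N \<le> i"
  shows "r i \<in> tail_component G r X"
  unfolding tail_component_def using assms(1) reach_tail[OF assms(1) order.refl assms(2)] by blast

lemma tail_componentD:
  assumes N: "tail_in (del_verts G X) r N" and w: "w \<in> tail_component G r X"
  shows "reach (del_verts G X) (r N) w"
proof -
  obtain M where M: "tail_in (del_verts G X) r M" "reach (del_verts G X) (r M) w"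
    using w unfolding tail_component_def by blast
  have "reach (del_verts G X) (r N) (r (max N M))" by (rule reach_tail[OF N]) auto
  moreover have "reach (del_verts G X) (r (max N M)) (r M)" by (rule reach_tail[OF M(1)]) auto
  ultimately show ?thesis using M(2) by (meson rtranclp_trans)
qed

lemma tail_in_later: "tail_in H r N \<Longrightarrow> N \<le> M \<Longrightarrow> tail_in H r M"
  by (simp add: tail_in_def)

text \<open>A component of \<open>G - Y\<close> that avoids \<open>X\<close> is connected in \<open>G - X\<close>, and it shares a tail of \<open>r\<close>
  with the component there.\<close>

lemma tail_component_antimono:
  assumes G: "simple_graph G" and r: "r \<in> rays G" and fin: "finite X" "finite Y"
    and disj: "tail_component G r Y \<inter> X = {}"
  shows "tail_component G r Y \<subseteq> tail_component G r X"
proof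
  fix w assume w: "w \<in> tail_component G r Y"
  obtain N where N: "tail_in (del_verts G X) r N" using obtain_tail_in_del_verts[OF r fin(1)] .
  obtain M where M: "tail_in (del_verts G Y) r M" using obtain_tail_in_del_verts[OF r fin(2)] .
  define K where "K = max N M"
  have K: "tail_in (del_verts G Y) r K" using tail_in_later[OF M] by (simp add: K_def)
  have "r K \<in> tail_component G r X" by (rule tail_in_tail_component[OF N]) (simp add: K_def)
  with tail_componentD[OF K w] show "w \<in> tail_component G r X"
  proof (induction rule: rtranclp_induct)
    case (step y z)
    have "reach (del_verts G Y) (r K) z" using step(1,2) by (rule rtranclp.rtrancl_into_rtrancl)
    then have "z \<in> tail_component G r Y" using K unfolding tail_component_def by blast
    then have "z \<notin> X" using disj by blast
    moreover have "{y, z} \<in> edges G" using step(2) by (simp add: del_verts_def)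
    ultimately show ?case using tail_component_step[OF G step.IH[OF step.prems]] by blast
  qed
qed

lemma is_path_iff_successively:
  "is_path G p \<longleftrightarrow> p \<noteq> [] \<and> distinct p \<and> set p \<subseteq> verts G \<and> successively (\<lambda>x y. {x, y} \<in> edges G) p"
  by (simp add: is_path_def successively_conv_nth)

lemma is_path_append2: "is_path G (p @ q) \<Longrightarrow> q \<noteq> [] \<Longrightarrow> is_path G q"
  by (auto simp: is_path_iff_successively successively_append_iff)

lemma reach_obtain_path:
  assumes H: "simple_graph H" and reach: "reach H a b" and b: "b \<in> verts H"
  obtains p where "is_path H p" "hd p = a" "last p = b"
proof -
  from reach have "\<exists>p. is_path H p \<and> hd p = a \<and> last p = b"
  proof (induction rule: converse_rtranclp_induct)
    case base
    have "is_path H [b]" using b by (simp add: is_path_def)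
    then show ?case by (intro exI[of _ "[b]"]) simp
  next
    case (step a y)
    then obtain p where p: "is_path H p" "hd p = y" "last p = b" by blast
    show ?case
    proof (cases "a \<in> set p")
      case True
      then obtain p1 p2 where p12: "p = p1 @ a # p2" by (meson split_list)
      have "is_path H (a # p2)" using p(1) unfolding p12 by (rule is_path_append2) simp
      moreover have "last (a # p2) = b" using p(3) by (simp add: p12)
      ultimately show ?thesis by (intro exI[of _ "a # p2"]) simp
    next
      case False
      have "a \<in> verts H" by (rule simple_graph_edge(1)[OF H step(1)])
      then have "is_path H (a # p)"
        using p step(1) False by (auto simp: is_path_iff_successively successively_Cons)
      moreover have "last (a # p) = b" using p by (simp add: is_path_def)
      ultimately show ?thesis by (intro exI[of _ "a # p"]) simp
    qed
  qed
  with that show ?thesis by blast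
qed

text \<open>The paths of a fan meet \<open>X\<close> only in their first vertex and end outside \<open>X\<close>. The latter
  excludes the trivial path, so that distinct paths of a fan have distinct ends.\<close>

definition fans :: "'v ugraph \<Rightarrow> (nat \<Rightarrow> 'v) \<Rightarrow> 'v set \<Rightarrow> 'v \<Rightarrow> 'v list set set" where
  "fans G r X x = {P.
     (\<forall>p\<in>P. is_path G p \<and> hd p = x \<and> last p \<in> range r - X \<and> set p \<inter> X = {x}) \<and>
     (\<forall>p\<in>P. \<forall>q\<in>P. p \<noteq> q \<longrightarrow> set p \<inter> set q = {x})}"

lemma fans_path:
  "P \<in> fans G r X x \<Longrightarrow> p \<in> P \<Longrightarrow>
    is_path G p \<and> hd p = x \<and> last p \<in> range r - X \<and> set p \<inter> X = {x}"
  unfolding fans_def by blast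

lemma fans_disjoint:
  "P \<in> fans G r X x \<Longrightarrow> p \<in> P \<Longrightarrow> q \<in> P \<Longrightarrow> p \<noteq> q \<Longrightarrow> set p \<inter> set q = {x}"
  unfolding fans_def by blast

lemma obtain_maximal_fan:
  obtains M where "M \<in> fans G r X x" "\<And>P. P \<in> fans G r X x \<Longrightarrow> M \<subseteq> P \<Longrightarrow> P = M"
proof -
  have "\<exists>M\<in>fans G r X x. \<forall>P\<in>fans G r X x. M \<subseteq> P \<longrightarrow> P = M"
  proof (rule subset_Zorn')
    fix C assume C: "subset.chain (fans G r X x) C"
    have "set p \<inter> set q = {x}"
      if PQ: "P \<in> C" "p \<in> P" "Q \<in> C" "q \<in> Q" and ne: "p \<noteq> q" for p q P Q
    proof -
      have "P \<subseteq> Q \<or> Q \<subseteq> P" using C PQ(1,3) unfolding subset_chain_def by blast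
      then obtain R where R: "R \<in> C" "p \<in> R" "q \<in> R" using PQ by blast
      have "R \<in> fans G r X x" using C R(1) unfolding subset_chain_def by blast
      then show ?thesis using R(2,3) ne by (rule fans_disjoint)
    qed
    moreover have "is_path G p \<and> hd p = x \<and> last p \<in> range r - X \<and> set p \<inter> X = {x}"
      if "P \<in> C" "p \<in> P" for p P
    proof -
      have "P \<in> fans G r X x" using C that(1) unfolding subset_chain_def by blast
      then show ?thesis using that(2) by (rule fans_path)
    qed
    ultimately show "\<Union>C \<in> fans G r X x" unfolding fans_def by blast
  qed
  with that show ?thesis by blast
qed

lemma finite_fan:
  assumes "non_dominated G r" "x \<in> verts G" "P \<in> fans G r X x"
  shows "finite P"
proof (rule ccontr)
  assume "infinite P"
  then have "dominates G x r"
    using fans_path[OF assms(3)] fans_disjoint[OF assms(3)] unfolding dominates_def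
    by (intro exI[of _ P]) simp
  then show False using assms(1,2) unfolding non_dominated_def by blast
qed

text \<open>The separator consists of the vertices outside \<open>X\<close> of one maximal fan for each vertex of
  \<open>X\<close>. A connection from \<open>X\<close> to the ray avoiding it would, from its last vertex in \<open>X\<close> on,
  extend the maximal fan of that vertex.\<close>

lemma non_dominated_obtain_separator:
  assumes G: "simple_graph G" and r: "r \<in> rays G" and nd: "non_dominated G r"
    and X: "finite X" "X \<subseteq> verts G"
  obtains Y where "finite Y" "Y \<subseteq> verts G" "Y \<inter> X = {}" "tail_component G r Y \<inter> X = {}"
proof -
  have "\<exists>M. M \<in> fans G r X x \<and> (\<forall>P\<in>fans G r X x. M \<subseteq> P \<longrightarrow> P = M)" for x
    using obtain_maximal_fan[of G r X x] by metis
  then obtain M where M: "\<And>x. M x \<in> fans G r X x"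
    and M_max: "\<And>x P. P \<in> fans G r X x \<Longrightarrow> M x \<subseteq> P \<Longrightarrow> P = M x"
    by metis
  define Y where "Y = (\<Union>x\<in>X. \<Union>p\<in>M x. set p) - X"
  have "finite (M x)" if "x \<in> X" for x
    using finite_fan[OF nd _ M] X(2) that by blast
  then have finY: "finite Y" unfolding Y_def using X(1) by simp
  have "set p \<subseteq> verts G" if "p \<in> M x" for x p
    using fans_path[OF M that] by (simp add: is_path_def)
  then have Y_verts: "Y \<subseteq> verts G" unfolding Y_def by blast
  have "tail_component G r Y \<inter> X = {}"
  proof (rule ccontr)
    assume "\<not> ?thesis"
    then obtain x' where x': "x' \<in> tail_component G r Y" "x' \<in> X" by blast
    let ?H = "del_verts G Y"
    obtain N where N: "tail_in ?H r N" using obtain_tail_in_del_verts[OF r finY] .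
    obtain K where K: "tail_in (del_verts G X) r K" using obtain_tail_in_del_verts[OF r X(1)] .
    define m where "m = max N K"
    have m: "tail_in ?H r m" using tail_in_later[OF N] by (simp add: m_def)
    have rX: "r m \<notin> X" using K by (auto simp: m_def tail_in_def del_verts_def)
    have rH: "r m \<in> verts ?H" using m by (simp add: tail_in_def)
    have "reach ?H x' (r m)" by (rule reach_sym[OF tail_componentD[OF m x'(1)]])
    then obtain p where p: "is_path ?H p" "hd p = x'" "last p = r m"
      by (rule reach_obtain_path[OF simple_graph_del_verts[OF G] _ rH])
    \<comment> \<open>From its last vertex in \<open>X\<close> on, this path could be added to a maximal fan.\<close>
    have "hd p \<in> set p" using p(1) by (simp add: is_path_def)
    then have "\<exists>x\<in>set p. x \<in> X" using p(2) x'(2) by blast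
    then obtain p1 x p2 where p12: "p = p1 @ x # p2" "x \<in> X" "\<forall>z\<in>set p2. z \<notin> X"
      using split_list_last_prop[of p "\<lambda>x. x \<in> X"] by blast
    let ?q = "x # p2"
    have qH: "is_path ?H ?q" using p(1) unfolding p12(1) by (rule is_path_append2) simp
    have q_last: "last ?q = r m" using p(3) by (simp add: p12(1))
    have q_path: "is_path G ?q" using qH by (auto simp: is_path_def del_verts_def)
    have q_Y: "set ?q \<inter> Y = {}" using qH by (auto simp: is_path_def del_verts_def)
    have q_X: "set ?q \<inter> X = {x}" using p12 by auto
    have q_M: "set p \<inter> set ?q = {x}" if "p \<in> M x" for p
    proof -
      have px: "set p \<inter> X = {x}" using fans_path[OF M that] by simp
      have "set p \<subseteq> Y \<union> X" using that p12(2) unfolding Y_def by blast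
      then show ?thesis using px q_Y q_X by blast
    qed
    have "insert ?q (M x) \<in> fans G r X x"
      unfolding fans_def
    proof (intro CollectI conjI[of "Ball _ _"] ballI impI)
      fix p assume p: "p \<in> insert ?q (M x)"
      have "is_path G ?q \<and> hd ?q = x \<and> last ?q \<in> range r - X \<and> set ?q \<inter> X = {x}"
        using q_path q_X q_last rX by (simp del: last.simps)
      with p show "is_path G p \<and> hd p = x \<and> last p \<in> range r - X \<and> set p \<inter> X = {x}"
        using fans_path[OF M] by blast
      fix q assume "q \<in> insert ?q (M x)" "p \<noteq> q"
      with p consider "p \<in> M x" "q \<in> M x" | "p = ?q" "q \<in> M x" | "p \<in> M x" "q = ?q" by blast
      then show "set p \<inter> set q = {x}"
      proof cases
        case 1
        then show ?thesis using fans_disjoint[OF M] \<open>p \<noteq> q\<close> by blast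
      next
        case 2
        then show ?thesis using q_M[of q] by (simp only: Int_commute)
      next
        case 3
        then show ?thesis using q_M[of p] by simp
      qed
    qed
    then have "?q \<in> M x" using M_max by blast
    moreover have "r m \<in> set ?q" using last_in_set[of ?q] unfolding q_last by simp
    ultimately have "r m \<in> Y" using p12(2) rX unfolding Y_def by blast
    then show False using rH by (simp add: del_verts_def)
  qed
  with finY Y_verts show thesis by (intro that[of Y]) (auto simp: Y_def)
qed


section \<open>The chain of a non-dominated ray\<close>

lemma edge_inside_open_star:
  assumes G: "simple_graph G" and e: "{y, z} \<in> edges G" and yz: "y \<in> W" "z \<in> W"
  shows "edge_inside G (open_star G W) y z"
  unfolding edge_inside_def
proof (intro conjI e subsetI)
  fix x assume "x \<in> segment_point y z ` {0..1}"
  then obtain t where t: "t \<in> {0..1}" "x = segment_point y z t" by blast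
  then have "x \<in> graph_points G" using segment_point_in_graph_points[OF e] by simp
  moreover from this have "point_support x \<noteq> {}" by (rule point_support_nonempty[OF G])
  moreover have "point_support x \<subseteq> {y, z}" using t(2) point_support_segment_point by simp
  ultimately show "x \<in> open_star G W" using yz unfolding open_star_def by blast
qed

text \<open>Each point of the star lies on a connected piece of an edge starting at a vertex of \<open>W\<close>,
  and the vertices of \<open>W\<close> are joined by edges that lie in the star.\<close>

lemma connectedin_open_star:
  assumes G: "simple_graph G" and W: "W \<subseteq> verts G" "a \<in> W"
    and reach: "\<And>w. w \<in> W \<Longrightarrow> (\<lambda>x y. {x, y} \<in> edges G \<and> x \<in> W \<and> y \<in> W)\<^sup>*\<^sup>* a w"
  shows "connectedin (graph_topology G) (open_star G W)"
proof -
  let ?S = "open_star G W"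
  define \<U> where "\<U> = {T. connectedin (graph_topology G) T \<and> vertex_point a \<in> T \<and> T \<subseteq> ?S}"
  have vS: "vertex_point w \<in> ?S" if "w \<in> W" for w
    using that W(1) by (auto simp: open_star_def vertex_point_in_graph_points)
  have join: "S \<subseteq> \<Union>\<U>"
    if w: "vertex_point w \<in> \<Union>\<U>" and S: "vertex_point w \<in> S" "connectedin (graph_topology G) S" "S \<subseteq> ?S"
    for w S
  proof -
    obtain T where T: "T \<in> \<U>" "vertex_point w \<in> T" using w by blast
    have "connectedin (graph_topology G) (T \<union> S)"
      using T S unfolding \<U>_def by (intro connectedin_Un) auto
    then have "T \<union> S \<in> \<U>" using T S(3) unfolding \<U>_def by auto
    then show ?thesis by blast
  qed
  have vertices: "vertex_point w \<in> \<Union>\<U>" if "w \<in> W" for w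
    using reach[OF that]
  proof (induction rule: rtranclp_induct)
    case base
    have "{vertex_point a} \<in> \<U>"
      unfolding \<U>_def using vS[OF W(2)]
      by (auto simp: connectedin_sing topspace_graph_topology open_star_def)
    then show ?case by blast
  next
    case (step y z)
    then have e: "edge_inside G ?S y z" by (intro edge_inside_open_star[OF G]) auto
    have "segment_point y z 0 \<in> segment_point y z ` {0..1}" "segment_point y z 1 \<in> segment_point y z ` {0..1}"
      by (intro imageI; simp)+
    moreover have "segment_point y z ` {0..1} \<subseteq> \<Union>\<U>"
    proof (rule join[OF step.IH])
      show "vertex_point y \<in> segment_point y z ` {0..1}" using calculation(1) by simp
      show "connectedin (graph_topology G) (segment_point y z ` {0..1})"
        using step(2) by (intro connectedin_edge_part) auto
      show "segment_point y z ` {0..1} \<subseteq> ?S" using e by (simp add: edge_inside_def)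
    qed
    ultimately show ?case by auto
  qed
  have half_edge: "segment_point u v t \<in> \<Union>\<U>"
    if e: "{u, v} \<in> edges G" and t: "0 < t" "t < 1" and u: "u \<in> W" for u v t
  proof -
    have "segment_point u v ` {0..t} \<subseteq> \<Union>\<U>"
    proof (rule join[OF vertices[OF u]])
      have "segment_point u v 0 \<in> segment_point u v ` {0..t}" using t by (intro imageI) simp
      then show "vertex_point u \<in> segment_point u v ` {0..t}" by simp
      show "connectedin (graph_topology G) (segment_point u v ` {0..t})"
        using t by (intro connectedin_edge_part[OF e]) auto
      show "segment_point u v ` {0..t} \<subseteq> ?S"
      proof clarify
        fix s assume s: "s \<in> {0..t}"
        have "segment_point u v s \<in> graph_points G"
          using segment_point_in_graph_points[OF e] s t by simp
        moreover have "u \<in> point_support (segment_point u v s)"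
          using s t simple_graph_edge(3)[OF G e] by (auto simp: point_support_def segment_point_apply)
        ultimately show "segment_point u v s \<in> ?S" using u by (auto simp: open_star_def)
      qed
    qed
    moreover have "segment_point u v t \<in> segment_point u v ` {0..t}" using t by (intro imageI) simp
    ultimately show ?thesis by (rule subsetD)
  qed
  have "?S \<subseteq> \<Union>\<U>"
  proof
    fix x assume x: "x \<in> ?S"
    then have "x \<in> graph_points G" by (simp add: open_star_def)
    with G show "x \<in> \<Union>\<U>"
    proof (cases rule: graph_points_cases)
      case (1 w)
      then have "w \<in> W" using x by (simp add: open_star_def)
      then show ?thesis using vertices 1 by simp
    next
      case (2 u v t)
      then have "u \<in> W \<or> v \<in> W"
        using x point_support_segment_point[of u v t] unfolding open_star_def by blast
      then show ?thesis
      proof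
        assume "u \<in> W"
        then show ?thesis using half_edge 2 by blast
      next
        assume "v \<in> W"
        moreover have "{v, u} \<in> edges G" using 2(1) by (simp add: insert_commute)
        ultimately have "segment_point v u (1 - t) \<in> \<Union>\<U>" using 2 by (intro half_edge) auto
        then show ?thesis using 2(4) segment_point_swap[of u v t] by simp
      qed
    qed
  qed
  then have "?S = \<Union>\<U>" unfolding \<U>_def by blast
  moreover have "connectedin (graph_topology G) (\<Union>\<U>)"
    by (rule connectedin_Union) (auto simp: \<U>_def)
  ultimately show ?thesis by simp
qed

text \<open>Edges leaving the component end in \<open>X\<close>, so the component and \<open>X\<close> together span a
  subcomplex that contains the star; subcomplexes are closed.\<close>

lemma closure_open_star_tail_component:
  assumes G: "simple_graph G"
  shows "graph_topology G closure_of open_star G (tail_component G r X) \<subseteq>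
    {x \<in> graph_points G. point_support x \<subseteq> tail_component G r X \<union> X}"
proof (rule closure_of_minimal[OF _ closedin_supported], clarify)
  fix x assume "x \<in> open_star G (tail_component G r X)"
  then have x: "x \<in> graph_points G" "point_support x \<inter> tail_component G r X \<noteq> {}"
    by (auto simp: open_star_def)
  have "point_support x \<subseteq> tail_component G r X \<union> X"
    using G x(1)
  proof (cases rule: graph_points_cases)
    case (2 u v t)
    have sub: "point_support x \<subseteq> {u, v}" using 2(4) point_support_segment_point by simp
    then consider "u \<in> tail_component G r X" | "v \<in> tail_component G r X" using x(2) by blast
    then show ?thesis
    proof cases
      case 1
      then show ?thesis using tail_component_step[OF G 1 2(1)] sub by blast
    next
      case b: 2
      have "{v, u} \<in> edges G" using 2(1) by (simp add: insert_commute)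
      then show ?thesis using tail_component_step[OF G b] b sub by blast
    qed
  qed (use x(2) in auto)
  with x(1) show "x \<in> graph_points G \<and> point_support x \<subseteq> tail_component G r X \<union> X" by blast
qed

text \<open>A frontier point is in the closure of the star but not in the star, hence in the finite,
  and therefore compact, subcomplex spanned by \<open>X\<close>.\<close>

lemma compactin_frontier_open_star_tail_component:
  assumes G: "simple_graph G" and X: "finite X"
  shows "compactin (graph_topology G)
    (graph_topology G frontier_of open_star G (tail_component G r X))"
proof (rule closed_compactin[OF compactin_supported[OF G X] _ closedin_frontier_of])
  let ?S = "open_star G (tail_component G r X)"
  have "graph_topology G frontier_of ?S = graph_topology G closure_of ?S - ?S"
    by (simp add: frontier_of_def interior_of_openin openin_open_star)
  then show "graph_topology G frontier_of ?S \<subseteq> {x \<in> graph_points G. point_support x \<subseteq> X}"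
    using closure_open_star_tail_component[OF G, of r X] unfolding open_star_def by blast
qed

lemma connectedin_open_star_tail_component:
  assumes G: "simple_graph G" and N: "tail_in (del_verts G X) r N"
  shows "connectedin (graph_topology G) (open_star G (tail_component G r X))"
proof (rule connectedin_open_star[OF G])
  let ?C = "tail_component G r X"
  show "?C \<subseteq> verts G" using tail_component_subset[OF G] by blast
  show "r N \<in> ?C" by (rule tail_in_tail_component[OF N order.refl])
  fix w assume "w \<in> ?C"
  from tail_componentD[OF N this]
  show "(\<lambda>x y. {x, y} \<in> edges G \<and> x \<in> ?C \<and> y \<in> ?C)\<^sup>*\<^sup>* (r N) w"
  proof (induction rule: rtranclp_induct)
    case (step y z)
    have z: "reach (del_verts G X) (r N) z" using step(1,2) by (rule rtranclp.rtrancl_into_rtrancl)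
    have "y \<in> ?C" "z \<in> ?C" using step(1) z N unfolding tail_component_def by blast+
    then have "{y, z} \<in> edges G \<and> y \<in> ?C \<and> z \<in> ?C" using step(2) by (simp add: del_verts_def)
    with step.IH show ?case by (rule rtranclp.rtrancl_into_rtrancl)
  qed simp
qed

text \<open>Starting with \<open>{r 0}\<close>, each \<open>X (Suc n)\<close> separates \<open>X n\<close> from the ray and is disjoint from
  \<open>X n\<close>. This makes the components decrease strictly enough to lose every vertex, even if
  \<open>G\<close> is uncountable or has vertices of infinite degree.\<close>

lemma non_dominated_obtain_chain:
  assumes G: "simple_graph G" and r: "r \<in> rays G" and nd: "non_dominated G r"
  obtains A where "end_chain (graph_topology G) A" "runs_into G r A"
proof -
  have "\<exists>X. \<forall>n. (finite (X n) \<and> X n \<subseteq> verts G \<and> (n = 0 \<longrightarrow> X n = {r 0})) \<and>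
    (X (Suc n) \<inter> X n = {} \<and> tail_component G r (X (Suc n)) \<inter> X n = {})"
  proof (rule dependent_nat_choice)
    show "\<exists>X. finite X \<and> X \<subseteq> verts G \<and> ((0::nat) = 0 \<longrightarrow> X = {r 0})"
      using raysD(2)[OF r] by auto
    fix X and n :: nat
    assume "finite X \<and> X \<subseteq> verts G \<and> (n = 0 \<longrightarrow> X = {r 0})"
    then obtain Y where "finite Y" "Y \<subseteq> verts G" "Y \<inter> X = {}" "tail_component G r Y \<inter> X = {}"
      using non_dominated_obtain_separator[OF G r nd] by metis
    then show "\<exists>Y. (finite Y \<and> Y \<subseteq> verts G \<and> (Suc n = 0 \<longrightarrow> Y = {r 0})) \<and>
      (Y \<inter> X = {} \<and> tail_component G r Y \<inter> X = {})" by auto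
  qed
  then obtain X where X_all: "\<forall>n. (finite (X n) \<and> X n \<subseteq> verts G \<and> (n = 0 \<longrightarrow> X n = {r 0})) \<and>
    (X (Suc n) \<inter> X n = {} \<and> tail_component G r (X (Suc n)) \<inter> X n = {})" ..
  have X: "finite (X n)" "X 0 = {r 0}" for n using X_all by simp_all
  have X_Suc: "X (Suc n) \<inter> X n = {}" "tail_component G r (X (Suc n)) \<inter> X n = {}" for n
    using X_all by simp_all
  define C where "C n = tail_component G r (X n)" for n
  define A where "A n = open_star G (C n)" for n
  have tail: "\<exists>N. tail_in (del_verts G (X n)) r N" for n
    using obtain_tail_in_del_verts[OF r X(1)] by metis
  have C_antimono: "C (Suc n) \<subseteq> C n" for n
    unfolding C_def by (rule tail_component_antimono[OF G r X(1) X(1) X_Suc(2)])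
  \<comment> \<open>A vertex in all the closures is in all the components, and so are its neighbours; hence
    it cannot be joined to \<open>r 0\<close>.\<close>
  have in_C: "w \<in> C n" if "\<And>n. w \<in> C n \<union> X n" for w n
    using that[of n] that[of "Suc n"] X_Suc[of n] unfolding C_def by blast
  have no_vertex: False if w: "\<And>n. w \<in> C n \<union> X n" for w
  proof -
    obtain N where N: "tail_in (del_verts G (X 0)) r N" using tail by blast
    have "reach (del_verts G (X 0)) (r N) w"
      using tail_componentD[OF N] in_C[OF w, of 0] by (simp add: C_def)
    then have "reach G (r N) w" by (rule reach_mono) (auto simp: del_verts_def)
    moreover have "reach G (r 0) (r N)" by (rule reach_ray_segment) (auto simp: raysD(3)[OF r])
    ultimately have "reach G (r 0) w" by (metis (no_types, lifting) rtranclp_trans)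
    then have "reach G w (r 0)" by (rule reach_sym)
    then have "r 0 \<in> C n \<union> X n" for n
    proof (induction arbitrary: n rule: rtranclp_induct)
      case (step y z)
      have "y \<in> C n" using step.IH by (rule in_C)
      then show ?case using tail_component_step[OF G _ step(2)] unfolding C_def by blast
    qed (rule w)
    then have "r 0 \<in> C 0" by (rule in_C)
    then show False using tail_component_subset[OF G, of r "X 0"] X(2) by (auto simp: C_def)
  qed
  have "runs_into G r A"
    unfolding runs_into_def
  proof
    fix n
    obtain N where N: "tail_in (del_verts G (X n)) r N" using tail by blast
    have "edge_inside G (A n) (r i) (r (Suc i))" if "N \<le> i" for i
      unfolding A_def C_def using that
      by (intro edge_inside_open_star[OF G raysD(3)[OF r]] tail_in_tail_component[OF N]) auto
    then show "\<exists>N. \<forall>i\<ge>N. edge_inside G (A n) (r i) (r (Suc i))" by blast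
  qed
  moreover have "end_chain (graph_topology G) A"
    unfolding end_chain_def
  proof (intro conjI allI)
    fix n
    show "openin (graph_topology G) (A n)" unfolding A_def by (rule openin_open_star)
    obtain N where N: "tail_in (del_verts G (X n)) r N" using tail by blast
    have "vertex_point (r N) \<in> A n"
      using tail_in_tail_component[OF N order.refl] raysD(2)[OF r]
      by (simp add: A_def C_def open_star_def vertex_point_in_graph_points)
    then show "A n \<noteq> {}" by blast
    show "connectedin (graph_topology G) (A n)"
      unfolding A_def C_def by (rule connectedin_open_star_tail_component[OF G N])
    show "A (Suc n) \<subseteq> A n" using C_antimono[of n] unfolding A_def open_star_def by blast
    show "compactin (graph_topology G) (graph_topology G frontier_of A n)"
      unfolding A_def C_def by (rule compactin_frontier_open_star_tail_component[OF G X(1)])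
  next
    show "(\<Inter>n. graph_topology G closure_of A n) = {}"
    proof (rule ccontr)
      assume "\<not> ?thesis"
      then obtain x where "\<And>n. x \<in> graph_topology G closure_of A n" by blast
      then have x: "x \<in> graph_points G" "point_support x \<subseteq> C n \<union> X n" for n
        using closure_open_star_tail_component[OF G, of r "X n"] unfolding A_def C_def by blast+
      obtain w where "w \<in> point_support x" using point_support_nonempty[OF G x(1)] by blast
      then show False using x(2) no_vertex[of w] by blast
    qed
  qed
  ultimately show thesis using that by blast
qed


section \<open>Topological ends and edge-ends\<close>

theorem proposition2p12:
  fixes G :: "'v ugraph"
  assumes "simple_graph G" and "infinite (verts G)"
  shows "(end_to_edge_end G \<circ> top_end_to_end G) ` topological_ends (graph_topology G) =
         {\<epsilon> \<in> edge_ends G. almost_non_dominated G \<epsilon>}"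
proof -
  note G = assms(1)
  let ?X = "graph_topology G"
  have image: "(end_to_edge_end G \<circ> top_end_to_end G) (end_chain_rel ?X `` {A}) = edge_end_rel G `` {r}"
    if "end_chain ?X A" "r \<in> rays G" "runs_into G r A" for A r
    using top_end_to_end_class[OF G that] end_to_edge_end_class[OF G that(2)] by simp
  have self: "r \<in> edge_end_rel G `` {r}" if "r \<in> rays G" for r
    by (rule equiv_class_self[OF equiv_edge_end_rel[OF G] that])
  show ?thesis
  proof (intro subset_antisym subsetI)
    fix \<epsilon> assume "\<epsilon> \<in> (end_to_edge_end G \<circ> top_end_to_end G) ` topological_ends ?X"
    then obtain A where A: "end_chain ?X A"
      and \<epsilon>: "\<epsilon> = (end_to_edge_end G \<circ> top_end_to_end G) (end_chain_rel ?X `` {A})"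
      unfolding topological_ends_def by (auto elim!: quotientE)
    obtain r where r: "r \<in> rays G" "runs_into G r A" using end_chain_obtain_ray[OF G A] .
    have "\<epsilon> = edge_end_rel G `` {r}" unfolding \<epsilon> by (rule image[OF A r])
    moreover have "non_dominated G r" by (rule non_dominated_if_runs_into[OF G A r(2)])
    ultimately show "\<epsilon> \<in> {\<epsilon> \<in> edge_ends G. almost_non_dominated G \<epsilon>}"
      using self[OF r(1)] quotientI[OF r(1), of "edge_end_rel G"]
      unfolding edge_ends_def almost_non_dominated_def by blast
  next
    fix \<epsilon> assume "\<epsilon> \<in> {\<epsilon> \<in> edge_ends G. almost_non_dominated G \<epsilon>}"
    then obtain q r where q: "q \<in> rays G" "\<epsilon> = edge_end_rel G `` {q}"
      and r: "r \<in> \<epsilon>" "non_dominated G r"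
      unfolding edge_ends_def almost_non_dominated_def by (auto elim!: quotientE)
    have qr: "(q, r) \<in> edge_end_rel G" using q(2) r(1) by simp
    then have rG: "r \<in> rays G" by (simp add: edge_end_rel_def)
    have "\<epsilon> = edge_end_rel G `` {r}"
      unfolding q(2) by (rule equiv_class_eq[OF equiv_edge_end_rel[OF G] qr])
    moreover obtain A where A: "end_chain ?X A" "runs_into G r A"
      using non_dominated_obtain_chain[OF G rG r(2)] .
    ultimately have "\<epsilon> = (end_to_edge_end G \<circ> top_end_to_end G) (end_chain_rel ?X `` {A})"
      using image[OF A(1) rG A(2)] by simp
    moreover have "end_chain_rel ?X `` {A} \<in> topological_ends ?X"
      unfolding topological_ends_def using A(1) by (intro quotientI) simp
    ultimately show "\<epsilon> \<in> (end_to_edge_end G \<circ> top_end_to_end G) ` topological_ends ?X"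
      by (rule image_eqI)
  qed
qed

end
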